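(* Let $f=h+\overline{g}$ be a harmonic mapping of the open unit disk $\mathbb{D}$ whose dilatation $\omega=g'/h'=q^2$ is the square of a meromorphic function $q$ in $\mathbb{D}$. Let $\tau=\tau(z)$ be a smooth real-valued function in $\mathbb{D}$ satisfying $$|\tau_z|\leq \frac{c}{1-|z|^2},\qquad z\in\mathbb{D},$$ for some constant $c<1$. If $$\left|\mathcal{S} f-2(\tau_{zz}-\tau_z^2)+\frac{4\bar{z}\tau_z}{1-|z|^2}\right|+e^{2\sigma}|K| \leq \frac{2\left(1+(1-|z|^2)^2\tau_{z\bar{z}}\right)}{(1-|z|^2)^2}\qquad\text{for all } z\in\mathbb{D},$$ then the lift $\widetilde{f}$ is injective in $\mathbb{D}$.
   Context: $\mathbb{D}=\{|z|<1\}$; subscripts $z,\bar z$ denote the Wirtinger derivatives, $\partial_z=\frac12(\partial_x-i\partial_y)$. A harmonic mapping of $\mathbb{D}$ is a complex-valued harmonic function written $f=h+\overline{g}$ with $h,g$ analytic in $\mathbb{D}$; it is assumed that $|h'|+|g'|\neq 0$ in $\mathbb{D}$, but $f$ is not required to be locally univalent. If its dilatation is $\omega=g'/h'=q^2$ with $q$ meromorphic, its Weierstrass--Enneper lift is the conformal immersion $\widetilde f=(U,V,W):\mathbb{D}\to\mathbb{R}^3$ onto a minimal surface $\Sigma=\widetilde f(\mathbb{D})$ given by $U=\mathrm{Re}\,f$, $V=\mathrm{Im}\,f$, $W(z)=2\,\mathrm{Im}\int_{z_0}^z h'(\zeta)q(\zeta)\,d\zeta$, for a fixed base point $z_0\in\mathbb{D}$.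 The first fundamental form of the surface is $e^{2\sigma}|dz|^2$ with $e^\sigma=|h'|+|g'|$; $K=-e^{-2\sigma}\Delta\sigma\le 0$ is the Gauss curvature of the surface at $\widetilde f(z)$. The Schwarzian derivative of $f$ is $\mathcal{S}f=2(\sigma_{zz}-\sigma_z^2)$. *)

theory Defs
  imports "HOL-Complex_Analysis.Complex_Analysis"
begin

abbreviation unit_disk :: "complex set" where
  "unit_disk \<equiv> ball 0 1"

definition partial_x :: "(complex \<Rightarrow> 'a::real_normed_vector) \<Rightarrow> complex \<Rightarrow> 'a" where
  "partial_x F z = frechet_derivative F (at z) 1"

definition partial_y :: "(complex \<Rightarrow> 'a::real_normed_vector) \<Rightarrow> complex \<Rightarrow> 'a" where
  "partial_y F z = frechet_derivative F (at z) \<i>"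

definition laplacian :: "(complex \<Rightarrow> real) \<Rightarrow> complex \<Rightarrow> real" where
  "laplacian u z = partial_x (partial_x u) z + partial_y (partial_y u) z"

definition wirtinger :: "(complex \<Rightarrow> complex) \<Rightarrow> complex \<Rightarrow> complex" where
  "wirtinger F z = (partial_x F z - \<i> * partial_y F z) / 2"

definition wirtinger_bar :: "(complex \<Rightarrow> complex) \<Rightarrow> complex \<Rightarrow> complex" where
  "wirtinger_bar F z = (partial_x F z + \<i> * partial_y F z) / 2"

text \<open>Meant for open \<open>S\<close>: the derivatives are two-sided, not relative to \<open>S\<close>.\<close>

fun Ck_on :: "nat \<Rightarrow> (complex \<Rightarrow> 'a::real_normed_vector) \<Rightarrow> complex set \<Rightarrow> bool" where
  "Ck_on 0 F S \<longleftrightarrow> continuous_on S F"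
| "Ck_on (Suc k) F S \<longleftrightarrow>
     (\<forall>z\<in>S. F differentiable (at z)) \<and> Ck_on k (partial_x F) S \<and> Ck_on k (partial_y F) S"

definition smooth_on :: "(complex \<Rightarrow> 'a::real_normed_vector) \<Rightarrow> complex set \<Rightarrow> bool" where
  "smooth_on F S \<longleftrightarrow> (\<forall>k. Ck_on k F S)"

definition harmonic_mapping ::
    "(complex \<Rightarrow> complex) \<Rightarrow> (complex \<Rightarrow> complex) \<Rightarrow> (complex \<Rightarrow> complex) \<Rightarrow> bool" where
  "harmonic_mapping f h g \<longleftrightarrow>
     h holomorphic_on unit_disk \<and> g holomorphic_on unit_disk \<and>
     (\<forall>z\<in>unit_disk. f z = h z + cnj (g z)) \<and>
     (\<forall>z\<in>unit_disk. cmod (deriv h z) + cmod (deriv g z) \<noteq> 0)"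

text \<open>The dilatation \<open>g'/h'\<close> is \<open>q\<^sup>2\<close> as a meromorphic function. It only makes sense if
  \<open>h'\<close> does not vanish identically, and its zeros are excluded because division by zero is
  totalised; there \<open>g' \<noteq> 0\<close>, so that \<open>q\<close> has a pole.\<close>

definition dilatation_is_square ::
    "(complex \<Rightarrow> complex) \<Rightarrow> (complex \<Rightarrow> complex) \<Rightarrow> (complex \<Rightarrow> complex) \<Rightarrow> bool" where
  "dilatation_is_square h g q \<longleftrightarrow>
     q meromorphic_on unit_disk \<and> (\<exists>z\<in>unit_disk. deriv h z \<noteq> 0) \<and>
     (\<forall>z\<in>unit_disk. deriv h z \<noteq> 0 \<longrightarrow> deriv g z / deriv h z = (q z)\<^sup>2)"

text \<open>The integrand \<open>h' q\<close> has only removable singularities in the disk, so the integral does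
  not depend on the path from \<open>z0\<close> to \<open>z\<close>; we take the segment. It meets only finitely many of
  the isolated points where \<open>meromorphic_on\<close> leaves the value of \<open>q\<close> unconstrained, and these
  do not affect the integral.\<close>

definition weierstrass_enneper_lift ::
    "(complex \<Rightarrow> complex) \<Rightarrow> (complex \<Rightarrow> complex) \<Rightarrow> (complex \<Rightarrow> complex) \<Rightarrow> complex \<Rightarrow> complex \<Rightarrow> real ^ 3"
  where
  "weierstrass_enneper_lift f h q z0 z =
     vector [Re (f z), Im (f z),
             2 * Im (contour_integral (linepath z0 z) (\<lambda>\<zeta>. deriv h \<zeta> * q \<zeta>))]"

definition log_conformal_factor ::
    "(complex \<Rightarrow> complex) \<Rightarrow> (complex \<Rightarrow> complex) \<Rightarrow> complex \<Rightarrow> real" where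
  "log_conformal_factor h g z = ln (cmod (deriv h z) + cmod (deriv g z))"

definition gauss_curvature ::
    "(complex \<Rightarrow> complex) \<Rightarrow> (complex \<Rightarrow> complex) \<Rightarrow> complex \<Rightarrow> real" where
  "gauss_curvature h g z =
     - exp (- 2 * log_conformal_factor h g z) * laplacian (log_conformal_factor h g) z"

definition harmonic_schwarzian ::
    "(complex \<Rightarrow> complex) \<Rightarrow> (complex \<Rightarrow> complex) \<Rightarrow> complex \<Rightarrow> complex" where
  "harmonic_schwarzian h g z =
     (let \<sigma> = complex_of_real \<circ> log_conformal_factor h g
      in 2 * (wirtinger (wirtinger \<sigma>) z - (wirtinger \<sigma> z)\<^sup>2))"

end

theory Submission
  imports Defs
begin

text \<open>Put \<open>\<rho> = \<tau> - ln (1 - \<bar>z\<bar>\<^sup>2)\<close>. Then the first term of the hypothesis is the modulus of the difference of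
  the Schwarzian derivatives \<open>2 (\<sigma>\<^sub>z\<^sub>z - \<sigma>\<^sub>z\<^sup>2)\<close> and \<open>2 (\<rho>\<^sub>z\<^sub>z - \<rho>\<^sub>z\<^sup>2)\<close>, the second is the Laplacian of \<open>\<sigma>\<close>, and the right
  hand side is half the Laplacian of \<open>\<rho>\<close>. The condition is thus about the surface and the
  conformal metric \<open>exp (2 \<rho>) \<bar>dz\<bar>\<^sup>2\<close> on the disk.

  Fix a point \<open>z1\<close> and let \<open>P\<close> be the squared distance in space from the lift to its value at \<open>z1\<close>. The
  condition implies that \<open>U = exp (\<rho> - \<sigma>) P\<close> is convex in this metric, by a computation
  with the Gauss formula and Cauchy-Schwarz (\<open>conformally_weighted_distance_convex_at\<close>, which takes the
  geometry of the surface from \<open>spinor_identities\<close> and \<open>squared_distance_jet\<close>). The zeros of \<open>U\<close> are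
  the points with the same image as \<open>z1\<close>, and they are isolated because the lift is an immersion. If any
  two points were joined by a geodesic, then \<open>U\<close> would be convex along it and a second zero would force
  \<open>U\<close> to vanish on all of it.

  Geodesics are replaced by a mountain pass argument. The bound on \<open>\<tau>\<^sub>z\<close> with \<open>c < 1\<close> makes all concentric circles
  strictly convex, which yields a strictly convex function whose sublevel sets are the closed disks
  (\<open>circles_strictly_convex\<close>). A strictly convex function becomes convex in the Euclidean sense near each
  point after a quadratic change of coordinate (\<open>strictly_convex_in_quadratic_chart\<close>), so two components of a
  sublevel set cannot merge at a higher level, and its sublevel sets in a closed disk are
  connected (\<open>connected_sublevel_of_strictly_convex\<close>). Applied to a small strictly convex
  perturbation of \<open>U\<close>, this leaves no room for a second zero
  (\<open>no_second_zero_of_convex_function\<close>).\<close>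

section \<open>Calculus of second order Wirtinger derivatives\<close>

text \<open>For a real function \<open>V\<close> of class \<open>C\<^sup>2\<close> on an open set, the remaining arguments stand for
  its Wirtinger derivatives: \<open>V1\<close> for the derivative in \<open>z\<close>, \<open>V2\<close> for the second derivative in
  \<open>z\<close>, and \<open>V3\<close> for the mixed one in \<open>z\<close> and \<open>cnj z\<close>. Carrying them as data lets them be computed
  by rules for sums, products, \<open>exp\<close> and \<open>ln\<close>. Along a curve \<open>z(t)\<close> the second derivative of \<open>V\<close> is
  \<open>2 Re (V2 z'\<^sup>2 + V1 z'') + 2 Re V3 \<bar>z'\<bar>\<^sup>2\<close>, so that convexity is read off from the real part of \<open>V3\<close>.\<close>

definition wirtinger_jet ::
    "complex set \<Rightarrow> (complex \<Rightarrow> real) \<Rightarrow> (complex \<Rightarrow> complex) \<Rightarrow> (complex \<Rightarrow> complex) \<Rightarrow>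
     (complex \<Rightarrow> complex) \<Rightarrow> bool" where
  "wirtinger_jet D V V1 V2 V3 \<longleftrightarrow>
     (\<forall>z\<in>D. (V has_derivative (\<lambda>v. 2 * Re (V1 z * v))) (at z) \<and>
            (V1 has_derivative (\<lambda>v. V2 z * v + V3 z * cnj v)) (at z)) \<and>
     continuous_on D V2 \<and> continuous_on D V3"

lemma of_real_two_Re_mult: "complex_of_real (2 * Re (a * v)) = a * v + cnj a * cnj v"
  by (metis complex_add_cnj complex_cnj_mult of_real_mult of_real_numeral)

lemma wirtinger_jetD:
  assumes "wirtinger_jet D V V1 V2 V3"
  shows "z \<in> D \<Longrightarrow> (V has_derivative (\<lambda>v. 2 * Re (V1 z * v))) (at z)"
    and "z \<in> D \<Longrightarrow> (V1 has_derivative (\<lambda>v. V2 z * v + V3 z * cnj v)) (at z)"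
    and "continuous_on D V2" and "continuous_on D V3"
    and "continuous_on D V" and "continuous_on D V1"
  using assms unfolding wirtinger_jet_def
  by (auto intro!: continuous_at_imp_continuous_on has_derivative_continuous)

lemma wirtinger_jet_add:
  assumes "wirtinger_jet D V V1 V2 V3" "wirtinger_jet D W W1 W2 W3"
  shows "wirtinger_jet D (\<lambda>z. V z + W z) (\<lambda>z. V1 z + W1 z) (\<lambda>z. V2 z + W2 z) (\<lambda>z. V3 z + W3 z)"
  using assms unfolding wirtinger_jet_def
  by (auto intro!: continuous_intros derivative_eq_intros simp: algebra_simps)

lemma wirtinger_jet_cmult:
  fixes c :: real
  assumes "wirtinger_jet D V V1 V2 V3"
  shows "wirtinger_jet D (\<lambda>z. c * V z) (\<lambda>z. of_real c * V1 z) (\<lambda>z. of_real c * V2 z)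
           (\<lambda>z. of_real c * V3 z)"
  using assms unfolding wirtinger_jet_def
  by (auto intro!: continuous_intros derivative_eq_intros simp: algebra_simps)

lemma wirtinger_jet_diff:
  assumes "wirtinger_jet D V V1 V2 V3" "wirtinger_jet D W W1 W2 W3"
  shows "wirtinger_jet D (\<lambda>z. V z - W z) (\<lambda>z. V1 z - W1 z) (\<lambda>z. V2 z - W2 z) (\<lambda>z. V3 z - W3 z)"
  using assms unfolding wirtinger_jet_def
  by (auto intro!: continuous_intros derivative_eq_intros simp: algebra_simps)

lemma wirtinger_jet_mult:
  assumes "wirtinger_jet D V V1 V2 V3" "wirtinger_jet D W W1 W2 W3"
  shows "wirtinger_jet D (\<lambda>z. V z * W z) (\<lambda>z. V1 z * of_real (W z) + of_real (V z) * W1 z)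
           (\<lambda>z. V2 z * of_real (W z) + 2 * V1 z * W1 z + of_real (V z) * W2 z)
           (\<lambda>z. V3 z * of_real (W z) + V1 z * cnj (W1 z) + cnj (V1 z) * W1 z + of_real (V z) * W3 z)"
proof -
  note d = wirtinger_jetD[OF assms(1)] and e = wirtinger_jetD[OF assms(2)]
  have "((\<lambda>z. V1 z * of_real (W z) + of_real (V z) * W1 z) has_derivative
      (\<lambda>v. (V2 z * of_real (W z) + 2 * V1 z * W1 z + of_real (V z) * W2 z) * v
         + (V3 z * of_real (W z) + V1 z * cnj (W1 z) + cnj (V1 z) * W1 z + of_real (V z) * W3 z) * cnj v)) (at z)"
    if "z \<in> D" for z
  proof -
    have "((\<lambda>z. V1 z * of_real (W z) + of_real (V z) * W1 z) has_derivative
      (\<lambda>v. V1 z * of_real (2 * Re (W1 z * v)) + (V2 z * v + V3 z * cnj v) * of_real (W z)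
         + (of_real (V z) * (W2 z * v + W3 z * cnj v) + of_real (2 * Re (V1 z * v)) * W1 z))) (at z)"
      by (rule derivative_eq_intros d(1,2)[OF that] e(1,2)[OF that] refl)+
    also have "(\<lambda>v. V1 z * of_real (2 * Re (W1 z * v)) + (V2 z * v + V3 z * cnj v) * of_real (W z)
         + (of_real (V z) * (W2 z * v + W3 z * cnj v) + of_real (2 * Re (V1 z * v)) * W1 z)) =
      (\<lambda>v. (V2 z * of_real (W z) + 2 * V1 z * W1 z + of_real (V z) * W2 z) * v
         + (V3 z * of_real (W z) + V1 z * cnj (W1 z) + cnj (V1 z) * W1 z + of_real (V z) * W3 z) * cnj v)"
      by (simp only: of_real_two_Re_mult) (simp add: algebra_simps)
    finally show ?thesis .
  qed
  moreover have "((\<lambda>z. V z * W z) has_derivative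
      (\<lambda>v. 2 * Re ((V1 z * of_real (W z) + of_real (V z) * W1 z) * v))) (at z)" if "z \<in> D" for z
    by (rule derivative_eq_intros d(1,2)[OF that] e(1,2)[OF that] refl)+
       (simp add: algebra_simps)
  ultimately show ?thesis
    using d e unfolding wirtinger_jet_def by (auto intro!: continuous_intros)
qed

lemma wirtinger_jet_exp:
  assumes "wirtinger_jet D V V1 V2 V3"
  shows "wirtinger_jet D (\<lambda>z. exp (V z)) (\<lambda>z. of_real (exp (V z)) * V1 z)
           (\<lambda>z. of_real (exp (V z)) * (V2 z + (V1 z)\<^sup>2))
           (\<lambda>z. of_real (exp (V z)) * (V3 z + V1 z * cnj (V1 z)))"
proof -
  note d = wirtinger_jetD[OF assms(1)]
  have D1: "((\<lambda>z. exp (V z)) has_derivative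
      (\<lambda>v. 2 * Re (of_real (exp (V z)) * V1 z * v))) (at z)" if "z \<in> D" for z
    by (rule derivative_eq_intros d(1,2)[OF that] refl)+ (simp add: algebra_simps)
  have "((\<lambda>z. of_real (exp (V z)) * V1 z) has_derivative
      (\<lambda>v. (of_real (exp (V z)) * (V2 z + (V1 z)\<^sup>2)) * v
         + (of_real (exp (V z)) * (V3 z + V1 z * cnj (V1 z))) * cnj v)) (at z)"
    if "z \<in> D" for z
  proof -
    have "((\<lambda>z. of_real (exp (V z)) * V1 z) has_derivative
      (\<lambda>v. of_real (exp (V z)) * (V2 z * v + V3 z * cnj v)
         + of_real (2 * Re (of_real (exp (V z)) * V1 z * v)) * V1 z)) (at z)"
      by (rule derivative_eq_intros d(1,2)[OF that] D1[OF that] refl)+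
    also have "(\<lambda>v. of_real (exp (V z)) * (V2 z * v + V3 z * cnj v)
         + of_real (2 * Re (of_real (exp (V z)) * V1 z * v)) * V1 z) =
      (\<lambda>v. (of_real (exp (V z)) * (V2 z + (V1 z)\<^sup>2)) * v
         + (of_real (exp (V z)) * (V3 z + V1 z * cnj (V1 z))) * cnj v)"
      by (subst of_real_two_Re_mult) (simp add: algebra_simps power2_eq_square)
    finally show ?thesis .
  qed
  with D1 show ?thesis
    using d unfolding wirtinger_jet_def by (auto intro!: continuous_intros)
qed

lemma wirtinger_jet_ln:
  assumes "wirtinger_jet D V V1 V2 V3" and pos: "\<And>z. z \<in> D \<Longrightarrow> 0 < V z"
  shows "wirtinger_jet D (\<lambda>z. ln (V z)) (\<lambda>z. V1 z / of_real (V z))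
           (\<lambda>z. V2 z / of_real (V z) - (V1 z / of_real (V z))\<^sup>2)
           (\<lambda>z. V3 z / of_real (V z) - V1 z * cnj (V1 z) / (of_real (V z))\<^sup>2)"
proof -
  note d = wirtinger_jetD[OF assms(1)]
  have nz: "V z \<noteq> 0" "complex_of_real (V z) \<noteq> 0" if "z \<in> D" for z
    using pos[OF that] by auto
  have D1: "((\<lambda>z. ln (V z)) has_derivative (\<lambda>v. 2 * Re (V1 z / of_real (V z) * v))) (at z)"
    if "z \<in> D" for z
    by (rule derivative_eq_intros d(1,2)[OF that] refl pos[OF that])+
       (use pos[OF that] in \<open>simp add: field_simps\<close>)
  have "((\<lambda>z. V1 z / of_real (V z)) has_derivative
      (\<lambda>v. (V2 z / of_real (V z) - (V1 z / of_real (V z))\<^sup>2) * v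
         + (V3 z / of_real (V z) - V1 z * cnj (V1 z) / (of_real (V z))\<^sup>2) * cnj v)) (at z)"
    if "z \<in> D" for z
  proof -
    have "((\<lambda>z. V1 z / of_real (V z)) has_derivative
      (\<lambda>v. ((V2 z * v + V3 z * cnj v) * of_real (V z) - V1 z * of_real (2 * Re (V1 z * v)))
           / (of_real (V z) * of_real (V z)))) (at z)"
      by (rule has_derivative_divide' d(1,2)[OF that] has_derivative_of_real refl nz(2)[OF that])+
    also have "(\<lambda>v. ((V2 z * v + V3 z * cnj v) * of_real (V z) - V1 z * of_real (2 * Re (V1 z * v)))
           / (of_real (V z) * of_real (V z))) = 
      (\<lambda>v. (V2 z / of_real (V z) - (V1 z / of_real (V z))\<^sup>2) * v
         + (V3 z / of_real (V z) - V1 z * cnj (V1 z) / (of_real (V z))\<^sup>2) * cnj v)"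
    proof -
      have "((A * v + B * w) * r - C * (C * v + E * w)) / (r * r) =
          (A / r - (C / r)\<^sup>2) * v + (B / r - C * E / r\<^sup>2) * w" if "r \<noteq> 0" for A B C E r v w :: complex
        using that by (simp add: power2_eq_square divide_simps) algebra
      from this[OF nz(2)[OF that]] show ?thesis
        by (subst of_real_two_Re_mult) blast
    qed
    finally show ?thesis .
  qed
  with D1 show ?thesis
    using d nz unfolding wirtinger_jet_def by (auto intro!: continuous_intros)
qed

lemma wirtinger_jet_norm_square:
  assumes "a holomorphic_on D" "open D"
  shows "wirtinger_jet D (\<lambda>z. (cmod (a z))\<^sup>2) (\<lambda>z. deriv a z * cnj (a z))
           (\<lambda>z. deriv (deriv a) z * cnj (a z)) (\<lambda>z. deriv a z * cnj (deriv a z))"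
proof -
  have h: "deriv a holomorphic_on D" "deriv (deriv a) holomorphic_on D"
    using assms by (auto intro!: holomorphic_deriv)
  have d: "(a has_derivative (\<lambda>v. deriv a z * v)) (at z)"
      "(deriv a has_derivative (\<lambda>v. deriv (deriv a) z * v)) (at z)" if "z \<in> D" for z
    using holomorphic_derivI[OF assms that] holomorphic_derivI[OF h(1) assms(2) that]
    by (auto simp: has_field_derivative_def)
  have "((\<lambda>z. (cmod (a z))\<^sup>2) has_derivative (\<lambda>v. 2 * Re (deriv a z * cnj (a z) * v))) (at z)"
    if "z \<in> D" for z
  proof -
    have eq: "(\<lambda>z. (cmod (a z))\<^sup>2) = (\<lambda>z. Re (a z * cnj (a z)))"
      by (auto simp: complex_mult_cnj cmod_power2)
    show ?thesis unfolding eq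
      by (rule derivative_eq_intros d[OF that] refl)+ (simp add: algebra_simps)
  qed
  moreover have "((\<lambda>z. deriv a z * cnj (a z)) has_derivative
     (\<lambda>v. deriv (deriv a) z * cnj (a z) * v + deriv a z * cnj (deriv a z) * cnj v)) (at z)"
    if "z \<in> D" for z
    by (rule derivative_eq_intros d[OF that] refl)+ (simp add: algebra_simps)
  ultimately show ?thesis
    using h[THEN holomorphic_on_imp_continuous_on]
      holomorphic_on_imp_continuous_on[OF assms(1)] unfolding wirtinger_jet_def
    by (intro conjI ballI continuous_intros) simp_all
qed

section \<open>Relation to the Wirtinger operators and the Laplacian\<close>

lemma wirtinger_eqI:
  assumes "(F has_derivative (\<lambda>v. a * v + b * cnj v)) (at z)"
  shows "wirtinger F z = a" "wirtinger_bar F z = b"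
  unfolding wirtinger_def wirtinger_bar_def partial_x_def partial_y_def
    frechet_derivative_at[OF assms, symmetric] by (auto simp: algebra_simps)

lemma wirtinger_jet_unique:
  assumes "wirtinger_jet D V V1 V2 V3" "open D" "z \<in> D"
  shows "wirtinger (complex_of_real \<circ> V) z = V1 z"
    and "wirtinger (wirtinger (complex_of_real \<circ> V)) z = V2 z"
    and "wirtinger_bar (wirtinger (complex_of_real \<circ> V)) z = V3 z"
proof -
  have 1: "wirtinger (complex_of_real \<circ> V) y = V1 y" if "y \<in> D" for y
  proof (rule wirtinger_eqI)
    show "((complex_of_real \<circ> V) has_derivative (\<lambda>v. V1 y * v + cnj (V1 y) * cnj v)) (at y)"
      using has_derivative_of_real[OF wirtinger_jetD(1)[OF assms(1) that], where 'a=complex]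
      by (simp only: of_real_two_Re_mult o_def)
  qed
  show "wirtinger (complex_of_real \<circ> V) z = V1 z" using 1 assms by blast
  have "(wirtinger (complex_of_real \<circ> V) has_derivative (\<lambda>v. V2 z * v + V3 z * cnj v)) (at z)"
    by (rule has_derivative_transform_within_open[OF wirtinger_jetD(2)[OF assms(1,3)] assms(2,3)])
       (simp add: 1)
  from wirtinger_eqI[OF this]
  show "wirtinger (wirtinger (complex_of_real \<circ> V)) z = V2 z"
    and "wirtinger_bar (wirtinger (complex_of_real \<circ> V)) z = V3 z" .
qed

lemma wirtinger_jet_cong:
  assumes "wirtinger_jet D V V1 V2 V3" "open D"
    and "\<And>z. z \<in> D \<Longrightarrow> V z = W z" "\<And>z. z \<in> D \<Longrightarrow> V1 z = W1 z"
    and "\<And>z. z \<in> D \<Longrightarrow> V2 z = W2 z" "\<And>z. z \<in> D \<Longrightarrow> V3 z = W3 z"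
  shows "wirtinger_jet D W W1 W2 W3"
proof -
  note d = wirtinger_jetD[OF assms(1)]
  have "(W has_derivative (\<lambda>v. 2 * Re (W1 z * v))) (at z)" if "z \<in> D" for z
    using has_derivative_transform_within_open[OF d(1)[OF that] assms(2) that assms(3)] assms(4)[OF that]
    by simp
  moreover have "(W1 has_derivative (\<lambda>v. W2 z * v + W3 z * cnj v)) (at z)" if "z \<in> D" for z
    using has_derivative_transform_within_open[OF d(2)[OF that] assms(2) that assms(4)]
      assms(5,6)[OF that] by simp
  moreover have "continuous_on D W2" "continuous_on D W3"
    using d(3,4) assms(5,6) by (simp_all cong: continuous_on_cong)
  ultimately show ?thesis by (simp add: wirtinger_jet_def)
qed

text \<open>Differentiability is a local matter and the derivatives are unique, so local formulas for
  them, different on each neighbourhood, glue to the global Wirtinger derivatives.\<close>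

lemma wirtinger_jet_local:
  assumes "\<And>z. z \<in> D \<Longrightarrow> \<exists>B V1 V2 V3. open B \<and> z \<in> B \<and> wirtinger_jet B V V1 V2 V3"
  shows "wirtinger_jet D V (wirtinger (complex_of_real \<circ> V))
           (wirtinger (wirtinger (complex_of_real \<circ> V)))
           (wirtinger_bar (wirtinger (complex_of_real \<circ> V)))"
proof -
  have ex: "\<exists>B. open B \<and> z \<in> B \<and> wirtinger_jet B V (wirtinger (complex_of_real \<circ> V))
           (wirtinger (wirtinger (complex_of_real \<circ> V)))
           (wirtinger_bar (wirtinger (complex_of_real \<circ> V)))" if z: "z \<in> D" for z
  proof -
    obtain B V1 V2 V3 where B: "open B" "z \<in> B" "wirtinger_jet B V V1 V2 V3"
      using assms[OF z] by blast
    have "wirtinger_jet B V (wirtinger (complex_of_real \<circ> V))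
           (wirtinger (wirtinger (complex_of_real \<circ> V)))
           (wirtinger_bar (wirtinger (complex_of_real \<circ> V)))"
      by (rule wirtinger_jet_cong[OF B(3,1) refl]) (simp_all add: wirtinger_jet_unique[OF B(3,1)])
    with B show ?thesis by blast
  qed
  have c: "isCont (wirtinger (wirtinger (complex_of_real \<circ> V))) z
         \<and> isCont (wirtinger_bar (wirtinger (complex_of_real \<circ> V))) z" if "z \<in> D" for z
    using ex[OF that] by (metis continuous_on_eq_continuous_at wirtinger_jetD(3,4))
  show ?thesis
    unfolding wirtinger_jet_def
    by (intro conjI ballI continuous_at_imp_continuous_on)
       (use ex c wirtinger_jetD(1,2) in blast)+
qed

lemma wirtinger_jet_laplacian:
  assumes "wirtinger_jet D V V1 V2 V3" "open D" "z \<in> D"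
  shows "laplacian V z = 4 * Re (V3 z)"
proof -
  note d = wirtinger_jetD[OF assms(1)]
  have x: "partial_x V y = 2 * Re (V1 y)" and y: "partial_y V y = 2 * Re (V1 y * \<i>)"
    if "y \<in> D" for y
    unfolding partial_x_def partial_y_def frechet_derivative_at[OF d(1)[OF that], symmetric]
    by simp_all
  have "((\<lambda>y. 2 * Re (V1 y)) has_derivative (\<lambda>v. 2 * Re (V2 z * v + V3 z * cnj v))) (at z)"
    by (rule derivative_eq_intros d(2)[OF assms(3)] refl)+ simp
  then have "(partial_x V has_derivative (\<lambda>v. 2 * Re (V2 z * v + V3 z * cnj v))) (at z)"
    by (rule has_derivative_transform_within_open[OF _ assms(2,3)]) (simp add: x)
  note X = frechet_derivative_at[OF this, symmetric]
  have "((\<lambda>y. 2 * Re (V1 y * \<i>)) has_derivative (\<lambda>v. 2 * Re ((V2 z * v + V3 z * cnj v) * \<i>))) (at z)"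
    by (rule derivative_eq_intros d(2)[OF assms(3)] refl)+ simp
  then have "(partial_y V has_derivative (\<lambda>v. 2 * Re ((V2 z * v + V3 z * cnj v) * \<i>))) (at z)"
    by (rule has_derivative_transform_within_open[OF _ assms(2,3)]) (simp add: y)
  note Y = frechet_derivative_at[OF this, symmetric]
  show ?thesis
    unfolding laplacian_def
    by (subst (1) partial_x_def, subst (1) partial_y_def) (simp add: X Y)
qed

lemma smooth_imp_wirtinger_jet:
  fixes V :: "complex \<Rightarrow> real"
  assumes "smooth_on V D" "open D"
  shows "wirtinger_jet D V (wirtinger (complex_of_real \<circ> V))
           (wirtinger (wirtinger (complex_of_real \<circ> V)))
           (wirtinger_bar (wirtinger (complex_of_real \<circ> V)))"
proof (rule wirtinger_jet_local)
  fix z assume z: "z \<in> D"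
  have "Ck_on (Suc (Suc 0)) V D" using assms(1) unfolding smooth_on_def by blast
  then have 0: "\<And>z. z \<in> D \<Longrightarrow> V differentiable (at z)"
    and 1: "\<And>z. z \<in> D \<Longrightarrow> partial_x V differentiable (at z)"
           "\<And>z. z \<in> D \<Longrightarrow> partial_y V differentiable (at z)"
    and 2: "continuous_on D (partial_x (partial_x V))" "continuous_on D (partial_y (partial_x V))"
           "continuous_on D (partial_x (partial_y V))" "continuous_on D (partial_y (partial_y V))"
    by auto
  have fd: "(F has_derivative (\<lambda>v. Re v * partial_x F y + Im v * partial_y F y)) (at y)"
    if "F differentiable (at y)" for F :: "complex \<Rightarrow> real" and y
  proof -
    have D: "(F has_derivative frechet_derivative F (at y)) (at y)"
      using that frechet_derivative_works by blast
    interpret l: linear "frechet_derivative F (at y)"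
      using D has_derivative_linear by blast
    have "frechet_derivative F (at y) v = Re v * partial_x F y + Im v * partial_y F y" for v
    proof -
      have "frechet_derivative F (at y) v = frechet_derivative F (at y) (Re v *\<^sub>R 1 + Im v *\<^sub>R \<i>)"
        by (rule arg_cong[where f = "frechet_derivative F (at y)"]) (simp add: complex_eq_iff)
      then show ?thesis by (simp add: l.add l.scale partial_x_def partial_y_def)
    qed
    then have "frechet_derivative F (at y) = (\<lambda>v. Re v * partial_x F y + Im v * partial_y F y)"
      by blast
    with D show ?thesis by simp
  qed
  let ?X = "partial_x V" and ?Y = "partial_y V"
  let ?V1 = "\<lambda>z. (complex_of_real (?X z) - \<i> * of_real (?Y z)) / 2"
  let ?a = "\<lambda>z. (complex_of_real (partial_x ?X z) - \<i> * of_real (partial_x ?Y z)) / 2"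
  let ?b = "\<lambda>z. (complex_of_real (partial_y ?X z) - \<i> * of_real (partial_y ?Y z)) / 2"
  have "wirtinger_jet D V ?V1 (\<lambda>z. (?a z - \<i> * ?b z) / 2) (\<lambda>z. (?a z + \<i> * ?b z) / 2)"
    unfolding wirtinger_jet_def
  proof (intro conjI ballI)
    fix y assume y: "y \<in> D"
    show "(V has_derivative (\<lambda>v. 2 * Re (?V1 y * v))) (at y)"
      using fd[OF 0[OF y]] by (rule has_derivative_eq_rhs) (simp add: fun_eq_iff field_simps)
    have "(?V1 has_derivative (\<lambda>v. (of_real (Re v * partial_x ?X y + Im v * partial_y ?X y)
          - \<i> * of_real (Re v * partial_x ?Y y + Im v * partial_y ?Y y)) / 2)) (at y)"
      by (rule bounded_linear.has_derivative[OF bounded_linear_divide]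
          derivative_eq_intros fd 1 y refl)+
    also have "(\<lambda>v. (complex_of_real (Re v * partial_x ?X y + Im v * partial_y ?X y)
          - \<i> * of_real (Re v * partial_x ?Y y + Im v * partial_y ?Y y)) / 2) =
       (\<lambda>v. (?a y - \<i> * ?b y) / 2 * v + (?a y + \<i> * ?b y) / 2 * cnj v)"
      by (auto simp: complex_eq_iff field_simps)
    finally show "(?V1 has_derivative (\<lambda>v. (?a y - \<i> * ?b y) / 2 * v + (?a y + \<i> * ?b y) / 2 * cnj v)) (at y)" .
  qed (intro continuous_intros 2; simp)+
  then show "\<exists>B V1 V2 V3. open B \<and> z \<in> B \<and> wirtinger_jet B V V1 V2 V3"
    using assms(2) z by blast
qed

section \<open>Connected sublevel sets by a mountain pass argument\<close>

text \<open>A mountain pass argument. The hypothesis says that every point has a neighbourhood in which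
  two points are joined without rising above the higher of them, and in which a point that is not the
  lowest is a limit of lower ones; convexity in a chart gives both. If \<open>z1\<close> and \<open>z2\<close> only became
  connected at a level \<open>l0\<close> above both their values, then by compactness they lie in a continuum
  \<open>K\<close> on which \<open>V\<close> does not exceed \<open>l0\<close>. The points reachable from \<open>z1\<close> strictly below \<open>l0\<close> have a closure
  that is relatively open in \<open>K\<close>, for two valleys meeting at a point of height \<open>l0\<close> would already be
  connected below \<open>l0\<close> near that point. So this closure contains \<open>z2\<close>, which is thus reachable
  below \<open>l0\<close>, a contradiction.\<close>

lemma mountain_pass_connected_sublevel:
  fixes M :: "'a::euclidean_space set" and V :: "'a \<Rightarrow> real"
  assumes "compact M" "connected M" "continuous_on M V"
    and loc: "\<And>x. x \<in> M \<Longrightarrow> \<exists>N. open N \<and> x \<in> N \<and> (\<forall>u\<in>N \<inter> M. \<forall>v\<in>N \<inter> M.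
        connected_component {y \<in> M. V y \<le> max (V u) (V v)} u v \<and>
        (V v < V u \<longrightarrow> u \<in> closure {y \<in> N \<inter> M. V y < V u}))"
    and z: "z1 \<in> M" "z2 \<in> M"
  shows "connected_component {y \<in> M. V y \<le> max (V z1) (V z2)} z1 z2"
proof -
  define A where "A l = {y \<in> M. V y \<le> l}" for l
  define L where "L = {l. connected_component (A l) z1 z2}"
  define m where "m = max (V z1) (V z2)"
  have A_mono: "A l \<subseteq> A l'" if "l \<le> l'" for l l' using that by (auto simp: A_def)
  have compA: "compact (A l)" for l
  proof -
    have "closed (M \<inter> V -` {..l})"
      using assms(1,3) continuous_closed_preimage compact_imp_closed closed_atMost by blast
    then have "compact (M \<inter> (M \<inter> V -` {..l}))" using assms(1) compact_Int_closed by blast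
    moreover have "M \<inter> (M \<inter> V -` {..l}) = A l" by (auto simp: A_def)
    ultimately show ?thesis by simp
  qed
  have Lm: "m \<le> l" if "l \<in> L" for l
    using that connected_component_in[of "A l" z1 z2] by (auto simp: L_def A_def m_def)
  have "bdd_above (V ` M)"
    by (intro bounded_imp_bdd_above compact_imp_bounded compact_continuous_image assms)
  then obtain b where b: "\<And>y. y \<in> M \<Longrightarrow> V y \<le> b" by (auto simp: bdd_above_def)
  then have "A b = M" by (auto simp: A_def)
  then have "b \<in> L"
    using assms(2) z unfolding L_def connected_component_def by blast
  then have Lne: "L \<noteq> {}" by blast
  have Lbd: "bdd_below L" using Lm by (auto simp: bdd_below_def)
  define l0 where "l0 = Inf L"
  have L_up: "l' \<in> L" if "l \<in> L" "l \<le> l'" for l l'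
    using that connected_component_of_subset[OF _ A_mono] unfolding L_def by blast
  have above: "l \<in> L" if "l0 < l" for l
    using that L_up cInf_less_iff[OF Lne Lbd] unfolding l0_def by (meson less_imp_le)
  \<comment> \<open>A nested sequence of continua through both points, one for each level slightly above \<open>l0\<close>.\<close>
  define C where "C n = connected_component_set (A (l0 + 1 / Suc n)) z1" for n
  define K where "K = \<Inter>(range C)"
  have zC: "z1 \<in> C n" "z2 \<in> C n" for n
  proof -
    have *: "connected_component (A (l0 + 1 / Suc n)) z1 z2"
      using above[of "l0 + 1 / Suc n"] by (simp add: L_def)
    then show "z1 \<in> C n" "z2 \<in> C n"
      unfolding C_def using connected_component_refl connected_component_in by fastforce+
  qed
  have "connected K" unfolding K_def
  proof (rule connected_nest)
    show "compact (C n)" for n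
      unfolding C_def
      by (meson closed_connected_component closed_Int_compact compA compact_imp_closed
          connected_component_subset bounded_subset compact_eq_bounded_closed)
    show "connected (C n)" for n by (simp add: C_def)
    show "C n \<subseteq> C k" if "k \<le> n" for k n
    proof -
      have "1 / real (Suc n) \<le> 1 / real (Suc k)" using that by (simp add: frac_le)
      then show ?thesis unfolding C_def by (intro connected_component_mono A_mono) simp
    qed
  qed
  have zK: "z1 \<in> K" "z2 \<in> K" using zC by (auto simp: K_def)
  have KA: "K \<subseteq> A l0"
  proof
    fix y assume "y \<in> K"
    then have *: "y \<in> A (l0 + 1 / Suc n)" for n
      using connected_component_subset unfolding K_def C_def by blast
    have "V y \<le> l0"
    proof (rule LIMSEQ_le_const)
      show "(\<lambda>n. l0 + 1 / Suc n) \<longlonglongrightarrow> l0"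
        using tendsto_add[OF tendsto_const[of l0] LIMSEQ_inverse_real_of_nat] by (simp add: inverse_eq_divide)
      show "\<exists>N. \<forall>n\<ge>N. V y \<le> l0 + 1 / Suc n" using * by (auto simp: A_def)
    qed
    with * show "y \<in> A l0" by (auto simp: A_def)
  qed
  have l0L: "l0 \<in> L"
    using \<open>connected K\<close> zK KA unfolding L_def connected_component_def by blast
  have "l0 \<le> m"
  proof (rule ccontr)
    assume "\<not> l0 \<le> m"
    then have Vz: "V z1 < l0" "V z2 < l0" by (auto simp: m_def)
    \<comment> \<open>The valley of \<open>z1\<close>: what is reachable from it strictly below the level \<open>l0\<close>.\<close>
    define G where "G = {y \<in> M. \<exists>l<l0. connected_component (A l) z1 y}"
    have G: "V y < l0" if "y \<in> G" for y
      using that connected_component_in unfolding G_def A_def by fastforce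
    have GM: "G \<subseteq> M" by (auto simp: G_def)
    have ext: "u \<in> G" if "v \<in> G" "u \<in> M" "V u < l0"
      "connected_component {y \<in> M. V y \<le> max (V u) (V v)} u v" for u v
    proof -
      obtain l where l: "l < l0" "connected_component (A l) z1 v" using \<open>v \<in> G\<close> by (auto simp: G_def)
      let ?l = "max l (max (V u) (V v))"
      have "connected_component (A ?l) z1 v"
        by (rule connected_component_of_subset[OF l(2) A_mono]) simp
      moreover have "connected_component (A ?l) u v"
        by (rule connected_component_of_subset[OF that(4)]) (auto simp: A_def)
      ultimately have "connected_component (A ?l) z1 u"
        using connected_component_trans connected_component_sym by metis
      moreover have "?l < l0" using l that G by auto
      ultimately show ?thesis using \<open>u \<in> M\<close> unfolding G_def by blast
    qed
    have z1G: "z1 \<in> G"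
      using Vz z connected_component_refl[of z1 "A (V z1)"] by (auto simp: G_def A_def)
    have key: "\<exists>N. open N \<and> x \<in> N \<and> N \<inter> K \<subseteq> closure G" if x: "x \<in> K" "x \<in> closure G" for x
    proof -
      have "x \<in> M" using x KA by (auto simp: A_def)
      obtain N where N: "open N" "x \<in> N" and
        N1: "\<And>u v. u \<in> N \<inter> M \<Longrightarrow> v \<in> N \<inter> M \<Longrightarrow> connected_component {y \<in> M. V y \<le> max (V u) (V v)} u v" and
        N2: "\<And>u v. u \<in> N \<inter> M \<Longrightarrow> v \<in> N \<inter> M \<Longrightarrow> V v < V u \<Longrightarrow> u \<in> closure {y \<in> N \<inter> M. V y < V u}"
        using loc[OF \<open>x \<in> M\<close>] by blast
      obtain u0 where u0: "u0 \<in> N" "u0 \<in> G"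
        using x N open_Int_closure_eq_empty by blast
      have below: "u \<in> G" if "u \<in> N \<inter> M" "V u < l0" for u
        using ext[OF u0(2) _ that(2) N1] that u0 GM by blast
      have "y \<in> closure G" if y: "y \<in> N" "y \<in> K" for y
      proof (cases "V y < l0")
        case True
        then show ?thesis using below y KA closure_subset by (fastforce simp: A_def)
      next
        case False
        then have "V y = l0" "y \<in> M" using y KA by (auto simp: A_def)
        then have "y \<in> closure {t \<in> N \<inter> M. V t < l0}"
          using N2[of y u0] y u0 GM G by auto
        then show ?thesis
          using closure_mono[of "{t \<in> N \<inter> M. V t < l0}" G] below by blast
      qed
      with N show ?thesis by blast
    qed
    have "openin (top_of_set K) (K \<inter> closure G)"
      unfolding openin_subopen[of "top_of_set K" "K \<inter> closure G"]
    proof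
      fix x assume x: "x \<in> K \<inter> closure G"
      obtain N where N: "open N" "x \<in> N" "N \<inter> K \<subseteq> closure G" using key[of x] x by blast
      have "openin (top_of_set K) (K \<inter> N)" using N(1) by blast
      then show "\<exists>T. openin (top_of_set K) T \<and> x \<in> T \<and> T \<subseteq> K \<inter> closure G"
        using N x by blast
    qed
    moreover have "closedin (top_of_set K) (K \<inter> closure G)"
      by (simp add: closedin_closed_Int)
    ultimately have "K \<inter> closure G = {} \<or> K \<inter> closure G = K"
      using \<open>connected K\<close> connected_clopen by blast
    then have "z2 \<in> closure G" using z1G zK closure_subset by blast
    obtain N where N: "open N" "z2 \<in> N" and
        N1: "\<And>u v. u \<in> N \<inter> M \<Longrightarrow> v \<in> N \<inter> M \<Longrightarrow> connected_component {y \<in> M. V y \<le> max (V u) (V v)} u v"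
      using loc[OF z(2)] by blast
    obtain u0 where "u0 \<in> N" "u0 \<in> G"
      using \<open>z2 \<in> closure G\<close> N open_Int_closure_eq_empty by blast
    then have "z2 \<in> G" using ext[OF _ z(2) Vz(2) N1] N z(2) GM by blast
    then obtain l where "l < l0" "l \<in> L" by (auto simp: G_def L_def)
    then show False using cInf_lower[OF _ Lbd] unfolding l0_def by fastforce
  qed
  then have "m \<in> L" using l0L L_up by blast
  then show ?thesis by (simp add: L_def A_def m_def)
qed

section \<open>Convexity in a conformal metric\<close>

text \<open>Geodesics of the metric \<open>exp (2 \<rho>) \<bar>dz\<bar>\<^sup>2\<close> satisfy \<open>z'' = - 2 \<rho>\<^sub>z z'\<^sup>2\<close>, and the
  Hessian of \<open>V\<close> in this metric is positive definite at \<open>x\<close> exactly if the strict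
  inequality below holds with \<open>b = \<rho>\<^sub>z(x)\<close>. The quadratic chart osculates the geodesics through \<open>x\<close>, so
  that at \<open>x\<close> the Euclidean Hessian in the chart equals the one in the metric. By
  continuity it stays positive near \<open>x\<close>, and \<open>V\<close> is convex in the chart. This takes the
  place of local geodesics.\<close>

lemma strictly_convex_in_quadratic_chart:
  assumes jet: "wirtinger_jet D V V1 V2 V3" and "open D" "x \<in> D"
    and strict: "cmod (V2 x - 2 * b * V1 x) < Re (V3 x)"
  shows "\<exists>\<delta>>0. (\<lambda>\<zeta>. x + \<zeta> - b * \<zeta>\<^sup>2) ` ball 0 \<delta> \<subseteq> D \<and>
           convex_on (ball 0 \<delta>) (\<lambda>\<zeta>. V (x + \<zeta> - b * \<zeta>\<^sup>2))"
proof -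
  note d = wirtinger_jetD[OF jet]
  define \<Phi> where "\<Phi> \<zeta> = x + \<zeta> - b * \<zeta>\<^sup>2" for \<zeta>
  define e where "e \<zeta> = 1 - 2 * b * \<zeta>" for \<zeta>
  \<comment> \<open>A lower bound, up to a positive factor, for the Hessian of \<open>V\<close> in the chart.\<close>
  define H where "H \<zeta> = Re (V3 (\<Phi> \<zeta>)) * (cmod (e \<zeta>))\<^sup>2
      - cmod (V2 (\<Phi> \<zeta>) * (e \<zeta>)\<^sup>2 - 2 * b * V1 (\<Phi> \<zeta>))" for \<zeta>
  have \<Phi>0: "\<Phi> 0 = x" by (simp add: \<Phi>_def)
  have contV: "isCont V1 x" "isCont V2 x" "isCont V3 x"
    using d(3,4,6) assms(2,3) continuous_on_eq_continuous_at by blast+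
  have cont\<Phi>: "isCont \<Phi> 0" unfolding \<Phi>_def by (intro continuous_intros)
  have "isCont H 0"
    unfolding H_def e_def
    by (intro continuous_intros isCont_o2[OF cont\<Phi>]; simp add: \<Phi>0 contV)
  moreover have "H 0 > 0" using strict by (simp add: H_def \<Phi>0 e_def)
  ultimately have "\<forall>\<^sub>F \<zeta> in nhds 0. H \<zeta> > 0"
    by (metis isContD order_tendstoD(1) tendsto_at_iff_tendsto_nhds)
  moreover have "\<forall>\<^sub>F \<zeta> in nhds 0. \<Phi> \<zeta> \<in> D"
    using cont\<Phi> assms(2,3) \<Phi>0
    by (metis isCont_def tendsto_at_iff_tendsto_nhds topological_tendstoD)
  ultimately have "\<forall>\<^sub>F \<zeta> in nhds 0. H \<zeta> > 0 \<and> \<Phi> \<zeta> \<in> D" by eventually_elim auto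
  then obtain \<delta> where "\<delta> > 0" and \<delta>: "\<And>\<zeta>. \<zeta> \<in> ball 0 \<delta> \<Longrightarrow> H \<zeta> > 0 \<and> \<Phi> \<zeta> \<in> D"
    unfolding eventually_nhds_metric by (auto simp: dist_commute)
  have "convex_on (ball 0 \<delta>) (\<lambda>\<zeta>. V (\<Phi> \<zeta>))"
  proof (rule convex_onI)
    fix t :: real and p q :: complex
    assume t: "0 < t" "t < 1" and pq: "p \<in> ball 0 \<delta>" "q \<in> ball 0 \<delta>"
    define \<eta> where "\<eta> = q - p"
    define l where "l s = p + of_real s * \<eta>" for s
    have l_in: "l s \<in> ball 0 \<delta>" if "s \<in> {0..1}" for s
    proof -
      have "l s = (1 - s) *\<^sub>R p + s *\<^sub>R q"
        by (simp add: l_def \<eta>_def scaleR_conv_of_real algebra_simps)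
      then show ?thesis using that pq convexD[OF convex_ball[of 0 \<delta>] pq, of "1 - s" s] by simp
    qed
    have D\<Phi>: "((\<lambda>s. \<Phi> (l s)) has_derivative (\<lambda>h. of_real h * (e (l s) * \<eta>))) (at s)" for s
      unfolding \<Phi>_def l_def e_def
      by (rule derivative_eq_intros refl)+ (simp add: algebra_simps)
    have dV: "((\<lambda>s. V (\<Phi> (l s))) has_real_derivative 2 * Re (V1 (\<Phi> (l s)) * (e (l s) * \<eta>))) (at s)"
      if "s \<in> {0..1}" for s
    proof -
      have "\<Phi> (l s) \<in> D" using \<delta> l_in that by blast
      from diff_chain_at[OF D\<Phi> d(1)[OF this]]
      have "((\<lambda>s. V (\<Phi> (l s))) has_derivative
          (\<lambda>h. 2 * Re (V1 (\<Phi> (l s)) * (of_real h * (e (l s) * \<eta>))))) (at s)"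
        by (simp only: o_def)
      moreover have "2 * Re (V1 (\<Phi> (l s)) * (of_real h * (e (l s) * \<eta>)))
          = 2 * Re (V1 (\<Phi> (l s)) * (e (l s) * \<eta>)) * h" for h
        by (simp add: algebra_simps)
      ultimately show ?thesis unfolding has_field_derivative_def by (simp only:)
    qed
    have d2V: "((\<lambda>s. 2 * Re (V1 (\<Phi> (l s)) * (e (l s) * \<eta>))) has_real_derivative
        2 * Re ((V2 (\<Phi> (l s)) * (e (l s))\<^sup>2 - 2 * b * V1 (\<Phi> (l s))) * \<eta>\<^sup>2)
        + 2 * Re (V3 (\<Phi> (l s))) * (cmod (e (l s) * \<eta>))\<^sup>2) (at s)"
      if "s \<in> {0..1}" for s
    proof -
      have "\<Phi> (l s) \<in> D" using \<delta> l_in that by blast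
      from diff_chain_at[OF D\<Phi> d(2)[OF this]]
      have 1: "((\<lambda>s. V1 (\<Phi> (l s))) has_derivative
          (\<lambda>h. V2 (\<Phi> (l s)) * (of_real h * (e (l s) * \<eta>)) + V3 (\<Phi> (l s)) * cnj (of_real h * (e (l s) * \<eta>)))) (at s)"
        by (simp only: o_def)
      have 2: "((\<lambda>s. e (l s) * \<eta>) has_derivative (\<lambda>h. of_real h * (- 2 * b * \<eta>\<^sup>2))) (at s)"
        unfolding e_def l_def
        by (rule derivative_eq_intros refl)+ (simp add: algebra_simps power2_eq_square)
      have "((\<lambda>s. 2 * Re (V1 (\<Phi> (l s)) * (e (l s) * \<eta>))) has_derivative
         (\<lambda>h. 2 * Re (V1 (\<Phi> (l s)) * (of_real h * (- 2 * b * \<eta>\<^sup>2)) +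
          (V2 (\<Phi> (l s)) * (of_real h * (e (l s) * \<eta>)) + V3 (\<Phi> (l s)) * cnj (of_real h * (e (l s) * \<eta>))) * (e (l s) * \<eta>)))) (at s)"
        by (rule has_derivative_mult_right has_derivative_Re has_derivative_mult 1 2)+
      moreover have "2 * Re (V1 (\<Phi> (l s)) * (of_real h * (- 2 * b * \<eta>\<^sup>2)) +
          (V2 (\<Phi> (l s)) * (of_real h * (e (l s) * \<eta>)) + V3 (\<Phi> (l s)) * cnj (of_real h * (e (l s) * \<eta>))) * (e (l s) * \<eta>))
         = (2 * Re ((V2 (\<Phi> (l s)) * (e (l s))\<^sup>2 - 2 * b * V1 (\<Phi> (l s))) * \<eta>\<^sup>2)
        + 2 * Re (V3 (\<Phi> (l s))) * (cmod (e (l s) * \<eta>))\<^sup>2) * h" for h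
      proof -
        have "V1 (\<Phi> (l s)) * (of_real h * (- 2 * b * \<eta>\<^sup>2)) +
          (V2 (\<Phi> (l s)) * (of_real h * (e (l s) * \<eta>)) + V3 (\<Phi> (l s)) * cnj (of_real h * (e (l s) * \<eta>))) * (e (l s) * \<eta>)
          = of_real h * ((V2 (\<Phi> (l s)) * (e (l s))\<^sup>2 - 2 * b * V1 (\<Phi> (l s))) * \<eta>\<^sup>2
            + V3 (\<Phi> (l s)) * ((e (l s) * \<eta>) * cnj (e (l s) * \<eta>)))"
          by (simp add: algebra_simps power2_eq_square)
        moreover have "2 * Re (of_real h * (X + Y * of_real r)) = (2 * Re X + 2 * Re Y * r) * h" for X Y r
          by (simp add: algebra_simps)
        ultimately show ?thesis by (simp only: complex_norm_square[symmetric])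
      qed
      ultimately show ?thesis unfolding has_field_derivative_def by (simp only:)
    qed
    have "convex_on {0..1} (\<lambda>s. V (\<Phi> (l s)))"
    proof (rule f''_ge0_imp_convex[OF _ dV d2V])
      fix s :: real assume s: "s \<in> {0..1}"
      let ?A = "V2 (\<Phi> (l s)) * (e (l s))\<^sup>2 - 2 * b * V1 (\<Phi> (l s))"
      have "- Re (?A * \<eta>\<^sup>2) \<le> cmod ?A * (cmod \<eta>)\<^sup>2"
        using abs_Re_le_cmod[of "?A * \<eta>\<^sup>2"] by (simp add: norm_mult norm_power)
      also have "\<dots> \<le> (Re (V3 (\<Phi> (l s))) * (cmod (e (l s)))\<^sup>2) * (cmod \<eta>)\<^sup>2"
        using \<delta>[OF l_in[OF s]] by (intro mult_right_mono) (auto simp: H_def)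
      finally show "0 \<le> 2 * Re (?A * \<eta>\<^sup>2) + 2 * Re (V3 (\<Phi> (l s))) * (cmod (e (l s) * \<eta>))\<^sup>2"
        by (simp add: norm_mult power_mult_distrib)
    qed auto
    from convex_onD[OF this, of t 0 1] t
    have "V (\<Phi> (l t)) \<le> (1 - t) * V (\<Phi> (l 0)) + t * V (\<Phi> (l 1))" by simp
    moreover have "l t = (1 - t) *\<^sub>R p + t *\<^sub>R q" "l 0 = p" "l 1 = q"
      by (simp_all add: l_def \<eta>_def scaleR_conv_of_real algebra_simps)
    ultimately show "V (\<Phi> ((1 - t) *\<^sub>R p + t *\<^sub>R q)) \<le> (1 - t) * V (\<Phi> p) + t * V (\<Phi> q)" by simp
  qed auto
  then show ?thesis using \<open>\<delta> > 0\<close> \<delta> unfolding \<Phi>_def by blast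
qed

lemma open_quadratic_chart:
  fixes x b :: complex
  assumes "\<delta> > 0"
  shows "open ((\<lambda>\<zeta>. x + \<zeta> - b * \<zeta>\<^sup>2) ` ball 0 \<delta>)"
proof (rule open_mapping_thm[of _ UNIV])
  show "\<not> (\<lambda>\<zeta>. x + \<zeta> - b * \<zeta>\<^sup>2) constant_on UNIV"
  proof
    assume "(\<lambda>\<zeta>. x + \<zeta> - b * \<zeta>\<^sup>2) constant_on UNIV"
    then obtain c where c: "x + \<zeta> - b * \<zeta>\<^sup>2 = c" for \<zeta>
      by (auto simp: constant_on_def)
    from c[of 0] c[of 1] c[of "-1"] show False by simp
  qed
qed (auto intro!: holomorphic_intros)

text \<open>The domain \<open>M\<close> is itself a sublevel set of a strictly convex function, so in a chart that is
  adapted to \<open>x\<close> both the domain and the sublevel sets of \<open>V\<close> are convex, also when \<open>x\<close> is a boundary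
  point. Segments in the chart then supply what the mountain pass argument asks for.\<close>

lemma connected_sublevel_of_strictly_convex:
  assumes jets: "wirtinger_jet D V V1 V2 V3" "wirtinger_jet D \<psi> \<psi>1 \<psi>2 \<psi>3" and "open D"
    and M: "compact M" "connected M" "M = {z \<in> D. \<psi> z \<le> R}"
    and V: "\<And>z. z \<in> M \<Longrightarrow> cmod (V2 z - 2 * b z * V1 z) < Re (V3 z)"
    and \<psi>: "\<And>z. z \<in> M \<Longrightarrow> cmod (\<psi>2 z - 2 * b z * \<psi>1 z) < Re (\<psi>3 z)"
    and z: "z1 \<in> M" "z2 \<in> M"
  shows "connected_component {y \<in> M. V y \<le> max (V z1) (V z2)} z1 z2"
proof (rule mountain_pass_connected_sublevel[OF M(1,2) _ _ z])
  have "M \<subseteq> D" using M(3) by blast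
  then show "continuous_on M V"
    using wirtinger_jetD(5)[OF jets(1)] continuous_on_subset by blast
  fix x assume x: "x \<in> M"
  then have "x \<in> D" using \<open>M \<subseteq> D\<close> by blast
  let ?\<Phi> = "\<lambda>\<zeta>. x + \<zeta> - b x * \<zeta>\<^sup>2"
  obtain \<delta>1 where \<delta>1: "\<delta>1 > 0" "?\<Phi> ` ball 0 \<delta>1 \<subseteq> D" "convex_on (ball 0 \<delta>1) (\<lambda>\<zeta>. V (?\<Phi> \<zeta>))"
    using strictly_convex_in_quadratic_chart[OF jets(1) \<open>open D\<close> \<open>x \<in> D\<close> V[OF x]] by blast
  obtain \<delta>2 where \<delta>2: "\<delta>2 > 0" "convex_on (ball 0 \<delta>2) (\<lambda>\<zeta>. \<psi> (?\<Phi> \<zeta>))"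
    using strictly_convex_in_quadratic_chart[OF jets(2) \<open>open D\<close> \<open>x \<in> D\<close> \<psi>[OF x]] by blast
  define \<delta> where "\<delta> = min \<delta>1 \<delta>2"
  have \<delta>: "\<delta> > 0" "?\<Phi> ` ball 0 \<delta> \<subseteq> D"
    and cV: "convex_on (ball 0 \<delta>) (\<lambda>\<zeta>. V (?\<Phi> \<zeta>))"
    and c\<psi>: "convex_on (ball 0 \<delta>) (\<lambda>\<zeta>. \<psi> (?\<Phi> \<zeta>))"
    using \<delta>1 \<delta>2 unfolding \<delta>_def by (auto intro: convex_on_subset)
  let ?N = "?\<Phi> ` ball 0 \<delta>"
  have "open ?N" by (rule open_quadratic_chart[OF \<delta>(1)])
  moreover have "x \<in> ?N" using \<delta>(1) by (intro image_eqI[of _ _ 0]) auto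
  moreover have "connected_component {y \<in> M. V y \<le> max (V u) (V v)} u v \<and>
        (V v < V u \<longrightarrow> u \<in> closure {y \<in> ?N \<inter> M. V y < V u})"
    if u: "u \<in> ?N \<inter> M" and v: "v \<in> ?N \<inter> M" for u v
  proof -
    obtain p q where p: "p \<in> ball 0 \<delta>" "u = ?\<Phi> p" and q: "q \<in> ball 0 \<delta>" "v = ?\<Phi> q"
      using u v by blast
    define l where "l t = (1 - t) *\<^sub>R p + t *\<^sub>R q" for t
    define \<gamma> where "\<gamma> t = ?\<Phi> (l t)" for t
    have lin: "l t \<in> ball 0 \<delta>" if "t \<in> {0..1}" for t
      using that convexD[OF convex_ball[of 0 \<delta>] p(1) q(1), of "1 - t" t] by (simp add: l_def)
    have \<gamma>V: "V (\<gamma> t) \<le> (1 - t) * V u + t * V v" if "t \<in> {0..1}" for t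
      using convex_onD[OF cV _ _ p(1) q(1), of t] that p q by (simp add: \<gamma>_def l_def)
    have \<gamma>\<psi>: "\<psi> (\<gamma> t) \<le> (1 - t) * \<psi> u + t * \<psi> v" if "t \<in> {0..1}" for t
      using convex_onD[OF c\<psi> _ _ p(1) q(1), of t] that p q by (simp add: \<gamma>_def l_def)
    have \<gamma>N: "\<gamma> t \<in> ?N" if "t \<in> {0..1}" for t
      using lin[OF that] by (auto simp: \<gamma>_def)
    have \<gamma>M: "\<gamma> t \<in> M" if "t \<in> {0..1}" for t
    proof -
      have "\<psi> (\<gamma> t) \<le> R"
        using \<gamma>\<psi>[OF that] convex_bound_le[of "\<psi> u" R "\<psi> v" "1 - t" t] u v M(3) that by auto
      moreover have "\<gamma> t \<in> D" using \<gamma>N[OF that] \<delta>(2) by blast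
      ultimately show ?thesis using M(3) by simp
    qed
    have cont: "continuous_on UNIV \<gamma>" unfolding \<gamma>_def l_def by (intro continuous_intros)
    have ends: "\<gamma> 0 = u" "\<gamma> 1 = v" using p q by (simp_all add: \<gamma>_def l_def)
    have "connected (\<gamma> ` {0..1})"
      using cont continuous_on_subset by (intro connected_continuous_image) auto
    moreover have "\<gamma> ` {0..1} \<subseteq> {y \<in> M. V y \<le> max (V u) (V v)}"
    proof safe
      fix t :: real assume t: "t \<in> {0..1}"
      show "\<gamma> t \<in> M" by (rule \<gamma>M[OF t])
      show "V (\<gamma> t) \<le> max (V u) (V v)"
        using \<gamma>V[OF t] convex_bound_le[of "V u" "max (V u) (V v)" "V v" "1 - t" t] t by simp
    qed
    moreover have "u \<in> \<gamma> ` {0..1}" "v \<in> \<gamma> ` {0..1}"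
      using ends by (metis atLeastAtMost_iff image_eqI order_refl zero_le_one)+
    ultimately have 1: "connected_component {y \<in> M. V y \<le> max (V u) (V v)} u v"
      unfolding connected_component_def by blast
    have 2: "u \<in> closure {y \<in> ?N \<inter> M. V y < V u}" if "V v < V u"
    proof -
      define s where "s n = 1 / real (Suc n)" for n
      have "s \<longlonglongrightarrow> 0"
        using LIMSEQ_inverse_real_of_nat by (simp only: s_def [abs_def] inverse_eq_divide)
      then have "(\<lambda>n. \<gamma> (s n)) \<longlonglongrightarrow> \<gamma> 0"
        using cont by (metis UNIV_I continuous_on_eq_continuous_at isCont_tendsto_compose open_UNIV)
      moreover have "\<gamma> (s n) \<in> {y \<in> ?N \<inter> M. V y < V u}" for n
      proof -
        have s: "0 < s n" "s n \<le> 1" by (simp_all add: s_def)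
        then have "V (\<gamma> (s n)) \<le> (1 - s n) * V u + s n * V v" by (intro \<gamma>V) auto
        also have "\<dots> = V u - s n * (V u - V v)" by (simp add: algebra_simps)
        also have "\<dots> < V u" using s that by simp
        finally show ?thesis using \<gamma>N[of "s n"] \<gamma>M[of "s n"] s by simp
      qed
      ultimately show ?thesis
        unfolding closure_sequential ends(1) by (intro exI[of _ "\<lambda>n. \<gamma> (s n)"] conjI allI)
    qed
    show ?thesis by (intro conjI impI 1 2)
  qed
  then have "\<forall>u\<in>?N \<inter> M. \<forall>v\<in>?N \<inter> M.
        connected_component {y \<in> M. V y \<le> max (V u) (V v)} u v \<and>
        (V v < V u \<longrightarrow> u \<in> closure {y \<in> ?N \<inter> M. V y < V u})" by (intro ballI)
  ultimately show "\<exists>N. open N \<and> x \<in> N \<and> (\<forall>u\<in>N \<inter> M. \<forall>v\<in>N \<inter> M.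
        connected_component {y \<in> M. V y \<le> max (V u) (V v)} u v \<and>
        (V v < V u \<longrightarrow> u \<in> closure {y \<in> N \<inter> M. V y < V u}))"
    by (intro exI[of _ ?N] conjI)
qed

section \<open>Holomorphic square roots of the Weierstrass data\<close>

text \<open>The function \<open>h' q\<close> is a square root of \<open>h' g'\<close>, hence bounded near its singularities,
  which are therefore removable.\<close>

lemma holomorphic_root_of_product:
  assumes "open D" "h' holomorphic_on D" "g' holomorphic_on D" "q meromorphic_on D"
    and sq: "\<And>z. z \<in> D \<Longrightarrow> h' z \<noteq> 0 \<Longrightarrow> g' z / h' z = (q z)\<^sup>2"
  obtains k pts where "k holomorphic_on D" "\<And>z. z \<in> D \<Longrightarrow> (k z)\<^sup>2 = h' z * g' z"
    "pts sparse_in D" "\<And>z. z \<in> D - pts \<Longrightarrow> k z = h' z * q z"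
proof -
  let ?f = "\<lambda>z. h' z * q z"
  define k where "k = remove_sings ?f"
  have f2: "(?f z)\<^sup>2 = h' z * g' z" if "z \<in> D" for z
  proof (cases "h' z = 0")
    case False
    then have "g' z = (q z)\<^sup>2 * h' z" using sq[OF that] by (simp add: field_simps)
    then show ?thesis by (simp add: power2_eq_square)
  qed simp
  have hm: "?f meromorphic_on D"
    using assms(1,2,4) by (intro meromorphic_intros) (simp_all add: analytic_on_imp_meromorphic_on analytic_on_open)
  have lim: "\<exists>c. ?f \<midarrow>z\<rightarrow> c" if z: "z \<in> D" for z
  proof -
    have ne: "not_essential ?f z"
      using hm z meromorphic_on_not_essential meromorphic_on_subset by blast
    have "\<not> is_pole ?f z"
    proof
      assume P: "is_pole ?f z"
      have "is_pole (\<lambda>w. (?f w)\<^sup>2) z"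
        using filterlim_at_infinity_times[OF P[unfolded is_pole_def] P[unfolded is_pole_def]]
        unfolding is_pole_def power2_eq_square .
      moreover have ev: "\<forall>\<^sub>F w in at z. (?f w)\<^sup>2 = h' w * g' w"
        using eventually_at_in_open'[OF assms(1) z] by eventually_elim (rule f2)
      ultimately have "is_pole (\<lambda>w. h' w * g' w) z"
        by (simp only: is_pole_cong[OF ev refl])
      moreover have "(\<lambda>w. h' w * g' w) analytic_on {z}"
        using assms z by (intro analytic_intros) (auto simp: analytic_at)
      ultimately show False
        using analytic_at_imp_no_pole by blast
    qed
    with ne show ?thesis by (auto simp: not_essential_def)
  qed
  have "k analytic_on {z}" if "z \<in> D" for z
    unfolding k_def using lim[OF that] remove_sings_analytic_at
      meromorphic_on_isolated_singularity meromorphic_on_subset[OF hm, of "{z}"] that by blast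
  then have "k holomorphic_on D"
    using assms(1) by (metis analytic_on_analytic_at analytic_on_open)
  moreover have "(k z)\<^sup>2 = h' z * g' z" if z: "z \<in> D" for z
  proof -
    obtain c where c: "?f \<midarrow>z\<rightarrow> c" using lim[OF z] by blast
    have "(\<lambda>w. (?f w)\<^sup>2) \<midarrow>z\<rightarrow> c\<^sup>2" by (intro tendsto_intros c)
    moreover have "\<forall>\<^sub>F w in at z. (?f w)\<^sup>2 = h' w * g' w"
      using eventually_at_in_open'[OF assms(1) z] by eventually_elim (rule f2)
    ultimately have "(\<lambda>w. h' w * g' w) \<midarrow>z\<rightarrow> c\<^sup>2"
      by (rule Lim_transform_eventually)
    moreover have "(\<lambda>w. h' w * g' w) \<midarrow>z\<rightarrow> h' z * g' z"
      using assms(1-3) z by (intro tendsto_mult)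
        (metis continuous_on_eq_continuous_at holomorphic_on_imp_continuous_on isCont_def)+
    ultimately have "c\<^sup>2 = h' z * g' z" using LIM_unique by blast
    moreover have "k z = c" unfolding k_def by (rule remove_sings_eqI[OF c])
    ultimately show ?thesis by simp
  qed
  moreover have "{w. \<not> ?f analytic_on {w}} sparse_in D"
    by (rule meromorphic_on_imp_sparse_singularities[OF hm])
  moreover have "k z = h' z * q z" if "z \<in> D - {w. \<not> ?f analytic_on {w}}" for z
    using that unfolding k_def by simp
  ultimately show ?thesis using that by blast
qed

text \<open>A segment is compact and meets a sparse set in finitely many points.\<close>

lemma contour_integral_linepath_eq_off_sparse:
  assumes "closed_segment a b \<subseteq> D" "open D" "pts sparse_in D" "k holomorphic_on D"
    and "\<And>z. z \<in> D - pts \<Longrightarrow> F z = k z"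
  shows "contour_integral (linepath a b) F = contour_integral (linepath a b) k"
proof (cases "a = b")
  case False
  have fin: "finite (closed_segment a b \<inter> pts)"
    by (metis assms(1,3) compact_segment inf_commute sparse_in_compact_finite sparse_in_subset)
  have cont: "continuous_on (closed_segment a b) k"
    using assms(1,4) holomorphic_on_imp_continuous_on continuous_on_subset by blast
  have "(k has_contour_integral contour_integral (linepath a b) k) (linepath a b)"
    by (rule has_contour_integral_integral[OF contour_integrable_continuous_linepath[OF cont]])
  then have 1: "((\<lambda>x. k (linepath a b x) * (b - a)) has_integral contour_integral (linepath a b) k) {0..1}"
    by (simp add: has_contour_integral_linepath)
  have "inj (linepath a b)"
  proof (rule injI)
    fix x y assume "linepath a b x = linepath a b y"
    then have "of_real (x - y) * (b - a) = 0"
      by (simp add: linepath_def scaleR_conv_of_real algebra_simps)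
    then show "x = y" using False by (simp del: of_real_diff)
  qed
  then have "finite (linepath a b -` (closed_segment a b \<inter> pts))"
    by (rule finite_vimageI[OF fin])
  then have "negligible (linepath a b -` (closed_segment a b \<inter> pts))"
    by (rule negligible_finite)
  then have "((\<lambda>x. F (linepath a b x) * (b - a)) has_integral contour_integral (linepath a b) k) {0..1}"
  proof (rule has_integral_spike[OF _ _ 1])
    fix x assume x: "x \<in> {0..1} - linepath a b -` (closed_segment a b \<inter> pts)"
    then have "linepath a b x \<in> closed_segment a b" using linepath_in_path by auto
    then have "linepath a b x \<in> D - pts" using x assms(1) by auto
    then show "F (linepath a b x) * (b - a) = k (linepath a b x) * (b - a)" by (simp add: assms(5))
  qed
  then have "(F has_contour_integral contour_integral (linepath a b) k) (linepath a b)"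
    by (simp add: has_contour_integral_linepath)
  then show ?thesis by (rule contour_integral_unique)
qed (simp add: contour_integral_trivial)

text \<open>Whichever of \<open>h'\<close> and \<open>g'\<close> does not vanish at \<open>z\<close> has a square root nearby; the other
  root is the quotient of \<open>k\<close> by it.\<close>

lemma local_square_roots:
  assumes "open D" "h' holomorphic_on D" "g' holomorphic_on D" "k holomorphic_on D"
    and k2: "\<And>z. z \<in> D \<Longrightarrow> (k z)\<^sup>2 = h' z * g' z"
    and z: "z \<in> D" "h' z \<noteq> 0 \<or> g' z \<noteq> 0"
  obtains B \<alpha> \<beta> where "open B" "z \<in> B" "B \<subseteq> D" "\<alpha> holomorphic_on B" "\<beta> holomorphic_on B"
    "\<And>w. w \<in> B \<Longrightarrow> h' w = (\<alpha> w)\<^sup>2" "\<And>w. w \<in> B \<Longrightarrow> g' w = (\<beta> w)\<^sup>2"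
    "\<And>w. w \<in> B \<Longrightarrow> k w = \<alpha> w * \<beta> w"
proof -
  have root: "\<exists>B \<alpha>. open B \<and> z \<in> B \<and> B \<subseteq> D \<and> \<alpha> holomorphic_on B \<and>
      (\<forall>w\<in>B. p w = (\<alpha> w)\<^sup>2 \<and> \<alpha> w \<noteq> 0)" if p: "p holomorphic_on D" "p z \<noteq> 0" for p
  proof -
    have "isCont p z"
      using p(1) assms(1) z continuous_on_eq_continuous_at holomorphic_on_imp_continuous_on by blast
    then obtain e1 where e1: "e1 > 0" "\<And>w. dist z w < e1 \<Longrightarrow> p w \<noteq> 0"
      using continuous_at_avoid p(2) by blast
    obtain e2 where e2: "e2 > 0" "ball z e2 \<subseteq> D" using assms(1) z open_contains_ball by blast
    define B where "B = ball z (min e1 e2)"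
    have B: "open B" "z \<in> B" "B \<subseteq> D" "\<And>w. w \<in> B \<Longrightarrow> p w \<noteq> 0"
      using e1 e2 by (auto simp: B_def)
    moreover have "p holomorphic_on B" using p(1) B(3) holomorphic_on_subset by blast
    ultimately obtain a where "a holomorphic_on B" "\<And>w. w \<in> B \<Longrightarrow> p w = (a w)\<^sup>2"
      using contractible_imp_holomorphic_sqrt[of p B] unfolding B_def
      by (metis convex_ball convex_imp_contractible)
    with B show ?thesis by (metis zero_power2)
  qed
  show ?thesis
  proof (cases "h' z = 0")
    case False
    obtain B a where B: "open B" "z \<in> B" "B \<subseteq> D" "a holomorphic_on B"
      "\<And>w. w \<in> B \<Longrightarrow> h' w = (a w)\<^sup>2 \<and> a w \<noteq> 0" using root[OF assms(2) False] by blast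
    show ?thesis
    proof (rule that[of B a "\<lambda>w. k w / a w"])
      show "(\<lambda>w. k w / a w) holomorphic_on B"
        using B assms(4) by (auto intro!: holomorphic_intros intro: holomorphic_on_subset)
      show "g' w = (k w / a w)\<^sup>2" if "w \<in> B" for w
        using k2[of w] B that by (auto simp: power_divide)
    qed (use B in auto)
  next
    case True
    then have "g' z \<noteq> 0" using z by simp
    then obtain B a where B: "open B" "z \<in> B" "B \<subseteq> D" "a holomorphic_on B"
      "\<And>w. w \<in> B \<Longrightarrow> g' w = (a w)\<^sup>2 \<and> a w \<noteq> 0" using root[OF assms(3)] by blast
    show ?thesis
    proof (rule that[of B "\<lambda>w. k w / a w" a])
      show "(\<lambda>w. k w / a w) holomorphic_on B"
        using B assms(4) by (auto intro!: holomorphic_intros intro: holomorphic_on_subset)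
      show "h' w = (k w / a w)\<^sup>2" if "w \<in> B" for w
        using k2[of w] B that by (auto simp: power_divide)
    qed (use B in auto)
  qed
qed

section \<open>The geometry of the lift\<close>

text \<open>The pointwise inequality behind the theorem. Put \<open>U = exp (\<rho> - \<sigma>) P\<close>, where \<open>P\<close> is the squared
  distance from the lift to a fixed point of space and \<open>A\<close> is the value of \<open>exp (\<rho> - \<sigma>)\<close>. The vector
  to that point has tangential part \<open>t\<close> and normal part \<open>n\<close>, \<open>e = exp \<sigma>\<close>, and
  \<open>a\<^sup>2 = - e\<^sup>2 K / 4\<close> is the mixed Wirtinger derivative of \<open>\<sigma>\<close>. The claim is that \<open>U\<close> is convex in
  the metric \<open>exp (2 \<rho>) \<bar>dz\<bar>\<^sup>2\<close>. In its Hessian the Schwarzian derivatives of \<open>\<sigma>\<close> and \<open>\<rho>\<close> appear only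
  through their difference \<open>T\<close>, which the hypothesis bounds; the remaining terms add up to at
  least a square plus the defect of Cauchy-Schwarz for \<open>(a, b)\<close> and \<open>(n, t)\<close>.\<close>

lemma conformally_weighted_distance_convex_at:
  fixes A a n t e :: real and \<rho>1 \<rho>2 \<rho>3 \<sigma>1 \<sigma>2 P1 P2 :: complex
  assumes "0 < A"
    and hyp: "cmod (2 * (\<sigma>2 - \<sigma>1\<^sup>2) - 2 * (\<rho>2 - \<rho>1\<^sup>2)) + 4 * a\<^sup>2 \<le> 2 * Re \<rho>3"
    and P: "P = n\<^sup>2 + t\<^sup>2" and P1: "cmod P1 = e * t"
    and P2: "cmod (P2 - 2 * \<sigma>1 * P1) \<le> 2 * e * a * n"
  defines "\<phi>1 \<equiv> \<rho>1 - \<sigma>1"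
  shows "cmod ((of_real A * ((\<rho>2 - \<sigma>2) + \<phi>1\<^sup>2) * of_real P + 2 * (of_real A * \<phi>1) * P1 + of_real A * P2)
            - 2 * \<rho>1 * (of_real A * \<phi>1 * of_real P + of_real A * P1))
    \<le> Re (of_real A * ((\<rho>3 - of_real (a\<^sup>2)) + \<phi>1 * cnj \<phi>1) * of_real P + of_real A * \<phi>1 * cnj P1
            + cnj (of_real A * \<phi>1) * P1 + of_real A * of_real (e\<^sup>2))"
proof -
  define T where "T = 2 * (\<sigma>2 - \<sigma>1\<^sup>2) - 2 * (\<rho>2 - \<rho>1\<^sup>2)"
  define b where "b = cmod \<phi>1"
  have "P \<ge> 0" by (simp add: P)
  have lhs: "(of_real A * ((\<rho>2 - \<sigma>2) + \<phi>1\<^sup>2) * of_real P + 2 * (of_real A * \<phi>1) * P1 + of_real A * P2)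
            - 2 * \<rho>1 * (of_real A * \<phi>1 * of_real P + of_real A * P1)
     = of_real A * (- (T / 2) * of_real P + (P2 - 2 * \<sigma>1 * P1))"
    by (simp add: T_def \<phi>1_def field_simps power2_eq_square)
  have "cmod (- (T / 2) * of_real P + (P2 - 2 * \<sigma>1 * P1)) \<le> cmod T / 2 * P + 2 * e * a * n"
    using \<open>P \<ge> 0\<close> P2 by (intro order_trans[OF norm_triangle_ineq] add_mono) (auto simp: norm_mult norm_divide)
  also have "\<dots> \<le> (Re \<rho>3 - 2 * a\<^sup>2) * P + 2 * e * a * n"
    using hyp \<open>P \<ge> 0\<close> by (intro add_right_mono mult_right_mono) (auto simp: T_def)
  also have "\<dots> \<le> (Re \<rho>3 - a\<^sup>2 + b\<^sup>2) * P - 2 * (b * (e * t)) + e\<^sup>2"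
  proof -
    have "0 \<le> (e - a * n - b * t)\<^sup>2 + (a * t - b * n)\<^sup>2" by simp
    also have "\<dots> = (a\<^sup>2 + b\<^sup>2) * P - 2 * e * a * n - 2 * (b * (e * t)) + e\<^sup>2"
      unfolding P by (simp add: power2_eq_square algebra_simps)
    finally show ?thesis by (simp add: algebra_simps)
  qed
  also have "\<dots> \<le> (Re \<rho>3 - a\<^sup>2 + b\<^sup>2) * P + 2 * Re (\<phi>1 * cnj P1) + e\<^sup>2"
    using abs_Re_le_cmod[of "\<phi>1 * cnj P1"] by (simp add: norm_mult P1 b_def)
  finally have "A * cmod (- (T / 2) * of_real P + (P2 - 2 * \<sigma>1 * P1)) \<le>
      A * ((Re \<rho>3 - a\<^sup>2 + b\<^sup>2) * P + 2 * Re (\<phi>1 * cnj P1) + e\<^sup>2)"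
    using \<open>0 < A\<close> by (intro mult_left_mono) auto
  moreover have "Re (of_real A * ((\<rho>3 - of_real (a\<^sup>2)) + \<phi>1 * cnj \<phi>1) * of_real P + of_real A * \<phi>1 * cnj P1
            + cnj (of_real A * \<phi>1) * P1 + of_real A * of_real (e\<^sup>2))
      = A * ((Re \<rho>3 - a\<^sup>2 + b\<^sup>2) * P + 2 * Re (\<phi>1 * cnj P1) + e\<^sup>2)"
  proof -
    have "\<phi>1 * cnj \<phi>1 = of_real (b\<^sup>2)" unfolding b_def by (rule complex_norm_square[symmetric])
    then show ?thesis by (simp add: algebra_simps flip: of_real_power)
  qed
  ultimately show ?thesis using \<open>0 < A\<close> unfolding lhs by (simp add: norm_mult)
qed

text \<open>The Weierstrass data of a minimal surface are \<open>h' = A\<^sup>2\<close>, \<open>g' = B\<^sup>2\<close>, and the integrand of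
  the third coordinate is \<open>A B\<close>; the conformal factor \<open>exp \<sigma>\<close> becomes \<open>S\<close>. With \<open>(\<xi>, \<omega>)\<close> the
  position vector, \<open>P1\<close> and \<open>P2\<close> are the first and second derivatives in \<open>z\<close> of its squared length, and
  \<open>N / S\<close> is its component along the unit normal. So the first identity is Pythagoras for the tangential
  and normal parts, the second is the Gauss formula for the second derivative of the immersion, and the
  third is the Gauss equation: the Wronskian \<open>A B1 - A1 B\<close> gives both the second fundamental form and
  the curvature.\<close>

lemma spinor_identities:
  fixes A B A1 B1 \<xi> :: complex and \<omega> S N :: real
  assumes S: "S = (cmod A)\<^sup>2 + (cmod B)\<^sup>2" and "S > 0"
    and N: "N = 2 * Im (cnj A * B * \<xi>) - \<omega> * ((cmod A)\<^sup>2 - (cmod B)\<^sup>2)"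
    and P1: "P1 = A\<^sup>2 * cnj \<xi> + B\<^sup>2 * \<xi> - 2 * \<i> * of_real \<omega> * (A * B)"
    and P2: "P2 = 2 * A * A1 * cnj \<xi> + 2 * B * B1 * \<xi> - 2 * \<i> * of_real \<omega> * (A1 * B + A * B1)"
  shows "(cmod P1)\<^sup>2 + N\<^sup>2 = S\<^sup>2 * ((cmod \<xi>)\<^sup>2 + \<omega>\<^sup>2)"
    and "P2 - 2 * ((A1 * cnj A + B1 * cnj B) / of_real S) * P1 = 2 * \<i> * (A * B1 - A1 * B) * of_real (N / S)"
    and "(A1 * cnj A1 + B1 * cnj B1) / of_real S
       - (A1 * cnj A + B1 * cnj B) * cnj (A1 * cnj A + B1 * cnj B) / (of_real S)\<^sup>2
       = of_real ((cmod (A * B1 - A1 * B) / S)\<^sup>2)"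
proof -
  have cS: "complex_of_real S = A * cnj A + B * cnj B"
    unfolding S by (simp add: complex_norm_square del: of_real_power)
  have im: "of_real (2 * Im w) = \<i> * (cnj w - w)" for w by (simp add: complex_eq_iff)
  have cN: "complex_of_real N = \<i> * (A * cnj B * cnj \<xi> - cnj A * B * \<xi>) - of_real \<omega> * (A * cnj A - B * cnj B)"
    unfolding N of_real_diff of_real_mult[of \<omega>] im complex_norm_square by (simp add: algebra_simps)
  \<comment> \<open>The identities are polynomial once conjugates are treated as independent variables.\<close>
  have ii: "\<i> * \<i> = -1" by simp
  have "complex_of_real ((cmod P1)\<^sup>2 + N\<^sup>2) = P1 * cnj P1 + of_real N * of_real N"
    by (simp add: complex_norm_square power2_eq_square[of "complex_of_real N"] del: of_real_power) (simp add: power2_eq_square)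
  also have "\<dots> = of_real S * of_real S * (\<xi> * cnj \<xi> + of_real \<omega> * of_real \<omega>)"
  proof -
    have cP: "cnj P1 = (cnj A)\<^sup>2 * \<xi> + (cnj B)\<^sup>2 * cnj \<xi> + 2 * \<i> * of_real \<omega> * (cnj A * cnj B)"
      by (simp add: P1)
    show ?thesis unfolding cP unfolding cS cN P1 using ii by algebra
  qed
  also have "\<dots> = of_real (S\<^sup>2 * ((cmod \<xi>)\<^sup>2 + \<omega>\<^sup>2))"
    by (simp add: complex_norm_square power2_eq_square[of "complex_of_real S"] power2_eq_square[of "complex_of_real \<omega>"] del: of_real_power) (simp add: power2_eq_square)
  finally show "(cmod P1)\<^sup>2 + N\<^sup>2 = S\<^sup>2 * ((cmod \<xi>)\<^sup>2 + \<omega>\<^sup>2)" by (simp only: of_real_eq_iff)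
  have "complex_of_real S * P2 - 2 * (A1 * cnj A + B1 * cnj B) * P1 = 2 * \<i> * (A * B1 - A1 * B) * of_real N"
    unfolding cS cN P1 P2 using ii by algebra
  then show "P2 - 2 * ((A1 * cnj A + B1 * cnj B) / of_real S) * P1 = 2 * \<i> * (A * B1 - A1 * B) * of_real (N / S)"
    using \<open>S > 0\<close> by (simp add: field_simps)
  have "(A1 * cnj A1 + B1 * cnj B1) * of_real S
       - (A1 * cnj A + B1 * cnj B) * cnj (A1 * cnj A + B1 * cnj B)
       = (A * B1 - A1 * B) * cnj (A * B1 - A1 * B)"
    unfolding cS by (simp add: algebra_simps)
  also have "\<dots> = of_real ((cmod (A * B1 - A1 * B))\<^sup>2)"
    by (rule complex_norm_square[symmetric])
  finally have "(A1 * cnj A1 + B1 * cnj B1) * of_real S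
       - (A1 * cnj A + B1 * cnj B) * cnj (A1 * cnj A + B1 * cnj B) = of_real ((cmod (A * B1 - A1 * B))\<^sup>2)" .
  note key = this
  show "(A1 * cnj A1 + B1 * cnj B1) / of_real S
       - (A1 * cnj A + B1 * cnj B) * cnj (A1 * cnj A + B1 * cnj B) / (of_real S)\<^sup>2
       = of_real ((cmod (A * B1 - A1 * B) / S)\<^sup>2)"
  proof -
    have gen: "X / s - Y / s\<^sup>2 = Z / s\<^sup>2" if "X * s - Y = Z" "s \<noteq> 0" for X Y Z s :: complex
      using that by (simp add: field_simps power2_eq_square)
    show ?thesis unfolding power_divide of_real_divide of_real_power[of S]
      by (rule gen) (use key \<open>S > 0\<close> in simp_all)
  qed
qed

text \<open>The coordinates of a minimal surface are harmonic, so the mixed derivative of the squared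
  distance comes from the first derivatives alone and is \<open>exp (2 \<sigma>)\<close>. In the second derivative in \<open>z\<close> the terms without a
  derivative of the Weierstrass data cancel because \<open>k\<^sup>2 = h' g'\<close>.\<close>

lemma squared_distance_jet:
  fixes \<xi> :: "complex \<Rightarrow> complex" and \<omega> :: "complex \<Rightarrow> real"
  assumes "open D" "h' holomorphic_on D" "g' holomorphic_on D" "k holomorphic_on D"
    and k2: "\<And>z. z \<in> D \<Longrightarrow> (k z)\<^sup>2 = h' z * g' z"
    and \<xi>: "\<And>z. z \<in> D \<Longrightarrow> (\<xi> has_derivative (\<lambda>v. h' z * v + cnj (g' z * v))) (at z)"
    and \<omega>: "\<And>z. z \<in> D \<Longrightarrow> (\<omega> has_derivative (\<lambda>v. 2 * Im (k z * v))) (at z)"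
  shows "wirtinger_jet D (\<lambda>z. (cmod (\<xi> z))\<^sup>2 + (\<omega> z)\<^sup>2)
     (\<lambda>z. h' z * cnj (\<xi> z) + g' z * \<xi> z - 2 * \<i> * of_real (\<omega> z) * k z)
     (\<lambda>z. deriv h' z * cnj (\<xi> z) + deriv g' z * \<xi> z - 2 * \<i> * of_real (\<omega> z) * deriv k z)
     (\<lambda>z. of_real ((cmod (h' z) + cmod (g' z))\<^sup>2))"
proof -
  have hol: "deriv h' holomorphic_on D" "deriv g' holomorphic_on D" "deriv k holomorphic_on D"
    using assms(1-4) by (auto intro!: holomorphic_deriv)
  have d: "(h' has_derivative (\<lambda>v. deriv h' z * v)) (at z)" "(g' has_derivative (\<lambda>v. deriv g' z * v)) (at z)"
     "(k has_derivative (\<lambda>v. deriv k z * v)) (at z)" if "z \<in> D" for z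
    using holomorphic_derivI[OF assms(2,1) that] holomorphic_derivI[OF assms(3,1) that]
      holomorphic_derivI[OF assms(4,1) that] by (auto simp: has_field_derivative_def)
  have cont: "continuous_on D \<xi>" "continuous_on D \<omega>"
    using has_derivative_continuous[OF \<xi>] has_derivative_continuous[OF \<omega>]
    by (auto intro: continuous_at_imp_continuous_on)
  show ?thesis unfolding wirtinger_jet_def
  proof (intro conjI ballI)
    fix z assume z: "z \<in> D"
    have eq: "(\<lambda>z. (cmod (\<xi> z))\<^sup>2 + (\<omega> z)\<^sup>2) = (\<lambda>z. Re (\<xi> z * cnj (\<xi> z)) + \<omega> z * \<omega> z)"
      by (simp add: fun_eq_iff cmod_power2) (simp add: power2_eq_square)
    show "((\<lambda>z. (cmod (\<xi> z))\<^sup>2 + (\<omega> z)\<^sup>2) has_derivative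
       (\<lambda>v. 2 * Re ((h' z * cnj (\<xi> z) + g' z * \<xi> z - 2 * \<i> * of_real (\<omega> z) * k z) * v))) (at z)"
      unfolding eq
      by (rule derivative_eq_intros \<xi>[OF z] \<omega>[OF z] refl)+ (simp add: algebra_simps)
    have im: "of_real (2 * Im w) = \<i> * (cnj w - w)" for w by (simp add: complex_eq_iff)
    have "(cmod (k z))\<^sup>2 = cmod (h' z) * cmod (g' z)" using k2[OF z] by (metis norm_mult norm_power)
    then have "(cmod (h' z) + cmod (g' z))\<^sup>2 = (cmod (h' z))\<^sup>2 + (cmod (g' z))\<^sup>2 + 2 * (cmod (k z))\<^sup>2"
      by (simp add: power2_sum)
    then have e: "complex_of_real ((cmod (h' z) + cmod (g' z))\<^sup>2) = h' z * cnj (h' z) + g' z * cnj (g' z) + 2 * (k z * cnj (k z))"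
      by (simp only: of_real_add of_real_mult complex_norm_square) simp
    have "((\<lambda>z. h' z * cnj (\<xi> z) + g' z * \<xi> z - 2 * \<i> * of_real (\<omega> z) * k z) has_derivative
      (\<lambda>v. (h' z * cnj (h' z * v + cnj (g' z * v)) + deriv h' z * v * cnj (\<xi> z))
        + (g' z * (h' z * v + cnj (g' z * v)) + deriv g' z * v * \<xi> z)
        - (2 * \<i> * of_real (\<omega> z) * (deriv k z * v) + 2 * \<i> * of_real (2 * Im (k z * v)) * k z))) (at z)"
      by (intro has_derivative_diff has_derivative_add has_derivative_mult has_derivative_mult_right
          has_derivative_cnj has_derivative_of_real \<xi>[OF z] \<omega>[OF z] d[OF z])
    moreover have "(h' z * cnj (h' z * v + cnj (g' z * v)) + deriv h' z * v * cnj (\<xi> z))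
        + (g' z * (h' z * v + cnj (g' z * v)) + deriv g' z * v * \<xi> z)
        - (2 * \<i> * of_real (\<omega> z) * (deriv k z * v) + 2 * \<i> * of_real (2 * Im (k z * v)) * k z)
       = (deriv h' z * cnj (\<xi> z) + deriv g' z * \<xi> z - 2 * \<i> * of_real (\<omega> z) * deriv k z) * v
        + of_real ((cmod (h' z) + cmod (g' z))\<^sup>2) * cnj v" for v
    proof -
      have ii: "\<i> * \<i> = -1" by simp
      show ?thesis unfolding e im complex_cnj_add complex_cnj_mult complex_cnj_cnj
        using ii k2[OF z] by algebra
    qed
    ultimately show "((\<lambda>z. h' z * cnj (\<xi> z) + g' z * \<xi> z - 2 * \<i> * of_real (\<omega> z) * k z) has_derivative
      (\<lambda>v. (deriv h' z * cnj (\<xi> z) + deriv g' z * \<xi> z - 2 * \<i> * of_real (\<omega> z) * deriv k z) * v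
        + of_real ((cmod (h' z) + cmod (g' z))\<^sup>2) * cnj v)) (at z)" by (simp only:)
  qed (intro continuous_intros cont holomorphic_on_imp_continuous_on hol assms(2,3); fail)+
qed

text \<open>The modulus of a holomorphic function is not smooth at a simple zero, but \<open>h'\<close> and \<open>g'\<close> are
  locally squares, and \<open>\<sigma>\<close> is smooth because locally \<open>\<sigma> = ln (\<bar>\<alpha>\<bar>\<^sup>2 + \<bar>\<beta>\<bar>\<^sup>2)\<close> with holomorphic \<open>\<alpha>\<close>, \<open>\<beta>\<close>. The second part collects the geometry of
  the surface at \<open>z\<close> with the local roots eliminated: \<open>n\<close> and \<open>t\<close> are the normal and tangential
  components of the position vector, and \<open>a\<^sup>2\<close> is a quarter of the Laplacian of \<open>\<sigma>\<close>.\<close>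

lemma log_conformal_factor_jet:
  assumes "open D" "deriv h holomorphic_on D" "deriv g holomorphic_on D" "k holomorphic_on D"
    and k2: "\<And>z. z \<in> D \<Longrightarrow> (k z)\<^sup>2 = deriv h z * deriv g z"
    and nz: "\<And>z. z \<in> D \<Longrightarrow> cmod (deriv h z) + cmod (deriv g z) \<noteq> 0"
  defines "\<sigma> \<equiv> complex_of_real \<circ> log_conformal_factor h g"
  shows "wirtinger_jet D (log_conformal_factor h g) (wirtinger \<sigma>) (wirtinger (wirtinger \<sigma>))
           (wirtinger_bar (wirtinger \<sigma>))"
    and "z \<in> D \<Longrightarrow> \<exists>a n t. wirtinger_bar (wirtinger \<sigma>) z = of_real (a\<^sup>2) \<and>
      (cmod \<xi>)\<^sup>2 + \<omega>\<^sup>2 = n\<^sup>2 + t\<^sup>2 \<and>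
      cmod (deriv h z * cnj \<xi> + deriv g z * \<xi> - 2 * \<i> * of_real \<omega> * k z)
        = exp (log_conformal_factor h g z) * t \<and>
      cmod ((deriv (deriv h) z * cnj \<xi> + deriv (deriv g) z * \<xi> - 2 * \<i> * of_real \<omega> * deriv k z)
         - 2 * wirtinger \<sigma> z * (deriv h z * cnj \<xi> + deriv g z * \<xi> - 2 * \<i> * of_real \<omega> * k z))
        \<le> 2 * exp (log_conformal_factor h g z) * a * n"
proof -
  have loc: "\<exists>B \<alpha> \<beta>. open B \<and> z \<in> B \<and> B \<subseteq> D \<and> \<alpha> holomorphic_on B \<and> \<beta> holomorphic_on B \<and>
     (\<forall>w\<in>B. deriv h w = (\<alpha> w)\<^sup>2 \<and> deriv g w = (\<beta> w)\<^sup>2 \<and> k w = \<alpha> w * \<beta> w)" if "z \<in> D" for z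
  proof -
    have "deriv h z \<noteq> 0 \<or> deriv g z \<noteq> 0" using nz[OF that] by auto
    from local_square_roots[OF assms(1-4) k2 that this] show ?thesis by metis
  qed
  have jet: "wirtinger_jet B (log_conformal_factor h g)
     (\<lambda>z. (deriv \<alpha> z * cnj (\<alpha> z) + deriv \<beta> z * cnj (\<beta> z)) / of_real ((cmod (\<alpha> z))\<^sup>2 + (cmod (\<beta> z))\<^sup>2))
     (\<lambda>z. (deriv (deriv \<alpha>) z * cnj (\<alpha> z) + deriv (deriv \<beta>) z * cnj (\<beta> z)) / of_real ((cmod (\<alpha> z))\<^sup>2 + (cmod (\<beta> z))\<^sup>2)
        - ((deriv \<alpha> z * cnj (\<alpha> z) + deriv \<beta> z * cnj (\<beta> z)) / of_real ((cmod (\<alpha> z))\<^sup>2 + (cmod (\<beta> z))\<^sup>2))\<^sup>2)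
     (\<lambda>z. (deriv \<alpha> z * cnj (deriv \<alpha> z) + deriv \<beta> z * cnj (deriv \<beta> z)) / of_real ((cmod (\<alpha> z))\<^sup>2 + (cmod (\<beta> z))\<^sup>2)
        - (deriv \<alpha> z * cnj (\<alpha> z) + deriv \<beta> z * cnj (\<beta> z)) * cnj (deriv \<alpha> z * cnj (\<alpha> z) + deriv \<beta> z * cnj (\<beta> z))
          / (of_real ((cmod (\<alpha> z))\<^sup>2 + (cmod (\<beta> z))\<^sup>2))\<^sup>2)"
    and lcf: "\<And>w. w \<in> B \<Longrightarrow> exp (log_conformal_factor h g w) = (cmod (\<alpha> w))\<^sup>2 + (cmod (\<beta> w))\<^sup>2"
    if B: "open B" "B \<subseteq> D" "\<alpha> holomorphic_on B" "\<beta> holomorphic_on B"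
      "\<forall>w\<in>B. deriv h w = (\<alpha> w)\<^sup>2 \<and> deriv g w = (\<beta> w)\<^sup>2 \<and> k w = \<alpha> w * \<beta> w" for B \<alpha> \<beta>
  proof -
    have eq: "cmod (deriv h w) + cmod (deriv g w) = (cmod (\<alpha> w))\<^sup>2 + (cmod (\<beta> w))\<^sup>2" if "w \<in> B" for w
      using B(5) that by (simp add: norm_power)
    have pos: "0 < (cmod (\<alpha> w))\<^sup>2 + (cmod (\<beta> w))\<^sup>2" if "w \<in> B" for w
      using nz[of w] B(2) that eq[OF that] by (smt (verit) subsetD zero_le_power2)
    show "wirtinger_jet B (log_conformal_factor h g)
     (\<lambda>z. (deriv \<alpha> z * cnj (\<alpha> z) + deriv \<beta> z * cnj (\<beta> z)) / of_real ((cmod (\<alpha> z))\<^sup>2 + (cmod (\<beta> z))\<^sup>2))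
     (\<lambda>z. (deriv (deriv \<alpha>) z * cnj (\<alpha> z) + deriv (deriv \<beta>) z * cnj (\<beta> z)) / of_real ((cmod (\<alpha> z))\<^sup>2 + (cmod (\<beta> z))\<^sup>2)
        - ((deriv \<alpha> z * cnj (\<alpha> z) + deriv \<beta> z * cnj (\<beta> z)) / of_real ((cmod (\<alpha> z))\<^sup>2 + (cmod (\<beta> z))\<^sup>2))\<^sup>2)
     (\<lambda>z. (deriv \<alpha> z * cnj (deriv \<alpha> z) + deriv \<beta> z * cnj (deriv \<beta> z)) / of_real ((cmod (\<alpha> z))\<^sup>2 + (cmod (\<beta> z))\<^sup>2)
        - (deriv \<alpha> z * cnj (\<alpha> z) + deriv \<beta> z * cnj (\<beta> z)) * cnj (deriv \<alpha> z * cnj (\<alpha> z) + deriv \<beta> z * cnj (\<beta> z))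
          / (of_real ((cmod (\<alpha> z))\<^sup>2 + (cmod (\<beta> z))\<^sup>2))\<^sup>2)"
      by (rule wirtinger_jet_cong[OF wirtinger_jet_ln[OF wirtinger_jet_add[OF
            wirtinger_jet_norm_square[OF B(3,1)] wirtinger_jet_norm_square[OF B(4,1)]] pos] B(1) _ refl refl refl])
         (simp_all add: eq log_conformal_factor_def)
    show "exp (log_conformal_factor h g w) = (cmod (\<alpha> w))\<^sup>2 + (cmod (\<beta> w))\<^sup>2" if "w \<in> B" for w
      using eq[OF that] pos[OF that] by (simp add: log_conformal_factor_def)
  qed
  show "wirtinger_jet D (log_conformal_factor h g) (wirtinger \<sigma>) (wirtinger (wirtinger \<sigma>))
           (wirtinger_bar (wirtinger \<sigma>))"
    unfolding \<sigma>_def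
  proof (rule wirtinger_jet_local)
    fix z assume z: "z \<in> D"
    obtain B \<alpha> \<beta> where B: "open B" "z \<in> B" "B \<subseteq> D" "\<alpha> holomorphic_on B" "\<beta> holomorphic_on B"
     "\<forall>w\<in>B. deriv h w = (\<alpha> w)\<^sup>2 \<and> deriv g w = (\<beta> w)\<^sup>2 \<and> k w = \<alpha> w * \<beta> w"
      using loc[OF z] by (elim exE conjE) (rule that)
    show "\<exists>B V1 V2 V3. open B \<and> z \<in> B \<and> wirtinger_jet B (log_conformal_factor h g) V1 V2 V3"
      by (intro exI conjI) (rule B(1), rule B(2), rule jet[OF B(1,3-6)])
  qed
  assume z: "z \<in> D"
  obtain B \<alpha> \<beta> where B: "open B" "z \<in> B" "B \<subseteq> D" "\<alpha> holomorphic_on B" "\<beta> holomorphic_on B" and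
     eqs: "\<forall>w\<in>B. deriv h w = (\<alpha> w)\<^sup>2 \<and> deriv g w = (\<beta> w)\<^sup>2 \<and> k w = \<alpha> w * \<beta> w"
    using loc[OF z] by (elim exE conjE) (rule that)
  note u = wirtinger_jet_unique[OF jet[OF B(1,3-5) eqs] B(1,2), folded \<sigma>_def]
  define S where "S = (cmod (\<alpha> z))\<^sup>2 + (cmod (\<beta> z))\<^sup>2"
  have S: "exp (log_conformal_factor h g z) = S" unfolding S_def by (rule lcf[OF B(1,3-5) eqs B(2)])
  have "S > 0" unfolding S[symmetric] by simp
  have d: "(\<alpha> has_field_derivative deriv \<alpha> z) (at z)" "(\<beta> has_field_derivative deriv \<beta> z) (at z)"
    using B holomorphic_derivI by blast+
  have dh: "deriv (deriv h) z = 2 * \<alpha> z * deriv \<alpha> z"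
  proof (rule DERIV_imp_deriv, rule has_field_derivative_transform_within_open[of "\<lambda>w. (\<alpha> w)\<^sup>2"])
    show "((\<lambda>w. (\<alpha> w)\<^sup>2) has_field_derivative 2 * \<alpha> z * deriv \<alpha> z) (at z)"
      by (rule derivative_eq_intros d refl)+ simp
  qed (use B eqs in auto)
  have dg: "deriv (deriv g) z = 2 * \<beta> z * deriv \<beta> z"
  proof (rule DERIV_imp_deriv, rule has_field_derivative_transform_within_open[of "\<lambda>w. (\<beta> w)\<^sup>2"])
    show "((\<lambda>w. (\<beta> w)\<^sup>2) has_field_derivative 2 * \<beta> z * deriv \<beta> z) (at z)"
      by (rule derivative_eq_intros d refl)+ simp
  qed (use B eqs in auto)
  have dk: "deriv k z = deriv \<alpha> z * \<beta> z + \<alpha> z * deriv \<beta> z"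
  proof (rule DERIV_imp_deriv, rule has_field_derivative_transform_within_open[of "\<lambda>w. \<alpha> w * \<beta> w"])
    show "((\<lambda>w. \<alpha> w * \<beta> w) has_field_derivative deriv \<alpha> z * \<beta> z + \<alpha> z * deriv \<beta> z) (at z)"
      by (rule derivative_eq_intros d refl)+ simp
  qed (use B eqs in auto)
  have e0: "deriv h z = (\<alpha> z)\<^sup>2" "deriv g z = (\<beta> z)\<^sup>2" "k z = \<alpha> z * \<beta> z" using eqs B(2) by auto
  define N where "N = 2 * Im (cnj (\<alpha> z) * \<beta> z * \<xi>) - \<omega> * ((cmod (\<alpha> z))\<^sup>2 - (cmod (\<beta> z))\<^sup>2)"
  define P1 where "P1 = (\<alpha> z)\<^sup>2 * cnj \<xi> + (\<beta> z)\<^sup>2 * \<xi> - 2 * \<i> * of_real \<omega> * (\<alpha> z * \<beta> z)"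
  define P2 where "P2 = 2 * \<alpha> z * deriv \<alpha> z * cnj \<xi> + 2 * \<beta> z * deriv \<beta> z * \<xi>
      - 2 * \<i> * of_real \<omega> * (deriv \<alpha> z * \<beta> z + \<alpha> z * deriv \<beta> z)"
  note I = spinor_identities[OF S_def \<open>S > 0\<close> N_def P1_def P2_def]
  define a where "a = cmod (\<alpha> z * deriv \<beta> z - deriv \<alpha> z * \<beta> z) / S"
  have "wirtinger_bar (wirtinger \<sigma>) z = of_real (a\<^sup>2)"
    unfolding u(3) a_def using I(3) by (simp only: S_def)
  moreover have "(cmod \<xi>)\<^sup>2 + \<omega>\<^sup>2 = \<bar>N / S\<bar>\<^sup>2 + (cmod P1 / S)\<^sup>2"
    using I(1) \<open>S > 0\<close> by (simp add: power_divide field_simps)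
  moreover have "cmod P1 = S * (cmod P1 / S)" using \<open>S > 0\<close> by simp
  moreover have "cmod (P2 - 2 * wirtinger \<sigma> z * P1) \<le> 2 * S * a * \<bar>N / S\<bar>"
    unfolding u(1) S_def[symmetric] I(2) using \<open>S > 0\<close> by (simp add: norm_mult norm_divide a_def)
  ultimately show "\<exists>a n t. wirtinger_bar (wirtinger \<sigma>) z = of_real (a\<^sup>2) \<and>
      (cmod \<xi>)\<^sup>2 + \<omega>\<^sup>2 = n\<^sup>2 + t\<^sup>2 \<and>
      cmod (deriv h z * cnj \<xi> + deriv g z * \<xi> - 2 * \<i> * of_real \<omega> * k z)
        = exp (log_conformal_factor h g z) * t \<and>
      cmod ((deriv (deriv h) z * cnj \<xi> + deriv (deriv g) z * \<xi> - 2 * \<i> * of_real \<omega> * deriv k z)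
         - 2 * wirtinger \<sigma> z * (deriv h z * cnj \<xi> + deriv g z * \<xi> - 2 * \<i> * of_real \<omega> * k z))
        \<le> 2 * exp (log_conformal_factor h g z) * a * n"
    unfolding dh dg dk e0 S P1_def[symmetric] P2_def[symmetric]
    by (intro exI[of _ a] exI[of _ "\<bar>N / S\<bar>"] exI[of _ "cmod P1 / S"] conjI)
qed

section \<open>The conformal metric on the disk\<close>

lemma norm_square_jet: "wirtinger_jet D (\<lambda>z. (cmod z)\<^sup>2) cnj (\<lambda>_. 0) (\<lambda>_. 1)"
  unfolding wirtinger_jet_def
proof (intro conjI ballI)
  fix z :: complex
  have eq: "(\<lambda>z. (cmod z)\<^sup>2) = (\<lambda>z. Re (z * cnj z))"
    by (simp add: fun_eq_iff cmod_power2) (simp add: power2_eq_square)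
  show "((\<lambda>z. (cmod z)\<^sup>2) has_derivative (\<lambda>v. 2 * Re (cnj z * v))) (at z)"
    unfolding eq by (rule derivative_eq_intros refl)+ (simp add: algebra_simps)
  show "(cnj has_derivative (\<lambda>v. 0 * v + 1 * cnj v)) (at z)"
    using has_derivative_cnj[OF has_derivative_ident] by simp
qed auto

lemma ln_hyperbolic_jet:
  "wirtinger_jet unit_disk (\<lambda>z. ln (1 - (cmod z)\<^sup>2)) (\<lambda>z. - (cnj z / of_real (1 - (cmod z)\<^sup>2)))
     (\<lambda>z. - (cnj z / of_real (1 - (cmod z)\<^sup>2))\<^sup>2) (\<lambda>z. - 1 / of_real ((1 - (cmod z)\<^sup>2)\<^sup>2))"
proof -
  have pos: "0 < 1 - (cmod z)\<^sup>2" if "z \<in> unit_disk" for z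
    using that by (simp add: abs_square_less_1)
  have const: "wirtinger_jet unit_disk (\<lambda>_. 1) (\<lambda>_. 0) (\<lambda>_. 0) (\<lambda>_. 0)"
    by (simp add: wirtinger_jet_def)
  have v3: "(0 - 1) / of_real (1 - (cmod z)\<^sup>2)
      - (0 - cnj z) * cnj (0 - cnj z) / (complex_of_real (1 - (cmod z)\<^sup>2))\<^sup>2
      = - 1 / of_real ((1 - (cmod z)\<^sup>2)\<^sup>2)" if "z \<in> unit_disk" for z
  proof -
    define u where "u = 1 - (cmod z)\<^sup>2"
    have "complex_of_real ((cmod z)\<^sup>2) = z * cnj z" by (rule complex_norm_square)
    then have "z * cnj z = 1 - of_real u" by (simp add: u_def)
    then have "(0 - cnj z) * cnj (0 - cnj z) = 1 - of_real u" by (simp add: mult.commute)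
    moreover have "(0 - 1) / w - (1 - w) / w\<^sup>2 = - 1 / w\<^sup>2" if "w \<noteq> 0" for w :: complex
      using that by (simp add: field_simps power2_eq_square)
    ultimately show ?thesis
      using pos[OF that] unfolding u_def[symmetric] of_real_power by simp
  qed
  show ?thesis
    by (rule wirtinger_jet_cong[OF wirtinger_jet_ln[OF wirtinger_jet_diff[OF const norm_square_jet] pos]])
       (simp_all add: v3[simplified])
qed

text \<open>For \<open>\<rho> = \<tau> - ln (1 - \<bar>z\<bar>\<^sup>2)\<close> and \<open>b = \<rho>\<^sub>z\<close> the conclusion says that \<open>exp (K \<bar>z\<bar>\<^sup>2)\<close> is strictly
  convex in the metric \<open>exp (2 \<rho>) \<bar>dz\<bar>\<^sup>2\<close> on a smaller disk. A large \<open>K\<close> dominates in the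
  radial direction, so what matters is that concentric circles are strictly convex, that is,
  \<open>1 + 2 Re (z \<rho>\<^sub>z) > 0\<close>. Here \<open>c < 1\<close> enters: \<open>2 \<bar>z\<bar> \<bar>\<tau>\<^sub>z\<bar>\<close> is at most \<open>c (1 + \<bar>z\<bar>\<^sup>2) / (1 - \<bar>z\<bar>\<^sup>2)\<close>,
  while \<open>1\<close> and the second summand of \<open>\<rho>\<^sub>z\<close> contribute \<open>(1 + \<bar>z\<bar>\<^sup>2) / (1 - \<bar>z\<bar>\<^sup>2)\<close>.\<close>

lemma circles_strictly_convex:
  fixes b \<tau>1 :: "complex \<Rightarrow> complex" and c r :: real
  assumes "c < 1" "r < 1" and cont: "continuous_on unit_disk \<tau>1"
    and bound: "\<And>z. z \<in> unit_disk \<Longrightarrow> cmod (\<tau>1 z) \<le> c / (1 - (cmod z)\<^sup>2)"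
    and b: "\<And>z. z \<in> unit_disk \<Longrightarrow> b z = \<tau>1 z + cnj z / of_real (1 - (cmod z)\<^sup>2)"
  shows "\<exists>K>0. \<forall>z\<in>cball 0 r. cmod ((of_real K * cnj z)\<^sup>2 - 2 * b z * (of_real K * cnj z))
            < K + K\<^sup>2 * (cmod z)\<^sup>2"
proof -
  have sub: "cball 0 r \<subseteq> unit_disk" using \<open>r < 1\<close> by auto
  have pos: "0 < 1 - (cmod z)\<^sup>2" if "z \<in> unit_disk" for z
    using that by (simp add: abs_square_less_1)
  have "continuous_on unit_disk (\<lambda>z. \<tau>1 z + cnj z / of_real (1 - (cmod z)\<^sup>2))"
    by (intro continuous_intros cont) (use pos in \<open>force simp del: of_real_diff\<close>)
  then have "continuous_on (cball 0 r) b"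
    using sub b by (metis (no_types, lifting) continuous_on_cong continuous_on_subset)
  then have "bounded (b ` cball 0 r)"
    by (intro compact_imp_bounded compact_continuous_image) auto
  then obtain m where m: "\<And>z. z \<in> cball 0 r \<Longrightarrow> cmod (b z) \<le> m"
    unfolding bounded_iff by blast
  \<comment> \<open>Chosen so that \<open>2 (1 - c) K\<close> exceeds the supremum of \<open>\<bar>2 b\<bar>\<^sup>2\<close>.\<close>
  define K where "K = (4 * m\<^sup>2 + 1) / (2 * (1 - c))"
  have K: "K > 0" "2 * (1 - c) * K = 4 * m\<^sup>2 + 1"
    using \<open>c < 1\<close> by (auto simp: K_def intro!: divide_pos_pos add_nonneg_pos)
  have "0 \<le> c" using bound[of 0] norm_ge_zero[of "\<tau>1 0"] by (simp del: norm_ge_zero)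
  have "cmod ((of_real K * cnj z)\<^sup>2 - 2 * b z * (of_real K * cnj z)) < K + K\<^sup>2 * (cmod z)\<^sup>2"
    if zr: "z \<in> cball 0 r" for z
  proof -
    have z: "z \<in> unit_disk" using zr sub by blast
    define s where "s = (cmod z)\<^sup>2"
    define u where "u = 1 - s"
    have u: "0 < u" "u \<le> 1" using pos[OF z] by (auto simp: u_def s_def)
    have s: "0 \<le> s" by (simp add: s_def)
    define a where "a = 2 * z * b z"
    have zz: "z * cnj z = of_real s" unfolding s_def by (rule complex_norm_square[symmetric])
    have "a = 2 * (z * \<tau>1 z) + 2 * (z * cnj z) / of_real u"
      unfolding a_def b[OF z] u_def s_def by (simp add: algebra_simps)
    then have "a = 2 * (z * \<tau>1 z) + of_real (2 * s / u)" unfolding zz by simp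
    then have "Re a = 2 * Re (z * \<tau>1 z) + 2 * s / u" by (simp del: of_real_divide of_real_mult)
    moreover have "\<bar>Re (z * \<tau>1 z)\<bar> \<le> cmod z * (c / u)"
    proof -
      have "\<bar>Re (z * \<tau>1 z)\<bar> \<le> cmod z * cmod (\<tau>1 z)"
        using abs_Re_le_cmod[of "z * \<tau>1 z"] by (simp only: norm_mult)
      also have "\<dots> \<le> cmod z * (c / u)"
        using bound[OF z] unfolding u_def s_def by (rule mult_left_mono) simp
      finally show ?thesis .
    qed
    ultimately have "1 + Re a \<ge> 1 + 2 * s / u - 2 * (cmod z * (c / u))" by linarith
    also have "1 + 2 * s / u - 2 * (cmod z * (c / u)) = (1 + s - c * (2 * cmod z)) / u"
    proof -
      have "1 + 2 * s / u - 2 * (cmod z * (c / u)) = (u + 2 * s - c * (2 * cmod z)) / u"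
        using u(1) by (simp add: field_simps)
      then show ?thesis by (simp add: u_def)
    qed
    finally have "1 + Re a \<ge> (1 + s - c * (2 * cmod z)) / u" .
    moreover have "c * (2 * cmod z) \<le> c * (1 + s)"
      using \<open>0 \<le> c\<close> sum_squares_bound[of "cmod z" 1] by (intro mult_left_mono) (auto simp: s_def)
    moreover have "1 - c \<le> (1 - c) * (1 + s) / u"
    proof -
      have "(1 - c) * u \<le> (1 - c) * (1 + s)" using \<open>c < 1\<close> u s by (intro mult_left_mono) auto
      then show ?thesis using u by (simp add: le_divide_eq)
    qed
    moreover have "(1 - c) * (1 + s) / u \<le> (1 + s - c * (2 * cmod z)) / u"
      using u calculation(2) by (intro divide_right_mono) (auto simp: algebra_simps)
    ultimately have Re_a: "1 - c \<le> 1 + Re a" by linarith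
    have "(cmod a)\<^sup>2 = 4 * (cmod (b z))\<^sup>2 * s"
      by (simp add: a_def norm_mult power_mult_distrib s_def)
    also have "\<dots> \<le> 4 * m\<^sup>2 * s"
      using m[OF zr] s by (intro mult_right_mono mult_left_mono power_mono) auto
    also have "\<dots> \<le> (2 * (1 - c) * K) * s" using s K(2) by (intro mult_right_mono) linarith+
    also have "\<dots> = 2 * K * s * (1 - c)" by simp
    also have "\<dots> \<le> 2 * K * s * (1 + Re a)" using Re_a K(1) s by (intro mult_left_mono) auto
    finally have ca: "(cmod a)\<^sup>2 \<le> 2 * K * s * (1 + Re a)" .
    have "(cmod (of_real (K * s) - a))\<^sup>2 = (K * s)\<^sup>2 - 2 * (K * s) * Re a + (cmod a)\<^sup>2"
      by (simp add: cmod_power2) (simp add: power2_eq_square algebra_simps)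
    also have "\<dots> < (1 + K * s)\<^sup>2" using ca by (simp add: power2_eq_square algebra_simps)
    finally have lt: "cmod (of_real (K * s) - a) < 1 + K * s"
      using K(1) s by (auto intro: power2_less_imp_less)
    have "cmod ((of_real K * cnj z)\<^sup>2 - 2 * b z * (of_real K * cnj z))
        = cmod (of_real K * cnj z * (of_real K * cnj z - 2 * b z))"
      by (simp add: power2_eq_square algebra_simps)
    also have "\<dots> = K * cmod (z * (of_real K * cnj z - 2 * b z))"
      using K(1) by (simp add: norm_mult)
    also have "z * (of_real K * cnj z - 2 * b z) = of_real (K * s) - a"
      using zz by (simp add: algebra_simps a_def)
    also have "K * cmod (of_real (K * s) - a) < K * (1 + K * s)" using lt K(1) by simp
    also have "\<dots> = K + K\<^sup>2 * (cmod z)\<^sup>2" by (simp add: s_def power2_eq_square algebra_simps)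
    finally show ?thesis .
  qed
  then show ?thesis using K(1) by blast
qed

text \<open>A convex function with two isolated zeros would have to pass a ridge between them. Adding a small
  multiple of the strictly convex function \<open>\<psi>\<close> makes it strictly convex, hence with connected
  sublevel sets on a closed disk; but then a low sublevel set reaches from \<open>z1\<close> to \<open>z2\<close> across a small
  circle around \<open>z1\<close> on which the function has a positive minimum.\<close>

lemma no_second_zero_of_convex_function:
  fixes U :: "complex \<Rightarrow> real" and b \<tau>1 :: "complex \<Rightarrow> complex" and c :: real
  assumes "c < 1" and cont: "continuous_on unit_disk \<tau>1"
    and bound: "\<And>z. z \<in> unit_disk \<Longrightarrow> cmod (\<tau>1 z) \<le> c / (1 - (cmod z)\<^sup>2)"
    and b: "\<And>z. z \<in> unit_disk \<Longrightarrow> b z = \<tau>1 z + cnj z / of_real (1 - (cmod z)\<^sup>2)"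
    and U: "wirtinger_jet unit_disk U U1 U2 U3"
    and convex: "\<And>z. z \<in> unit_disk \<Longrightarrow> cmod (U2 z - 2 * b z * U1 z) \<le> Re (U3 z)"
    and z: "z1 \<in> unit_disk" "z2 \<in> unit_disk" "U z1 = 0" "U z2 = 0"
    and isolated: "\<forall>\<^sub>F z in at z1. 0 < U z"
  shows "z1 = z2"
proof (rule ccontr)
  assume "z1 \<noteq> z2"
  obtain r where r: "cmod z1 < r" "cmod z2 < r" "r < 1"
    using dense[of "max (cmod z1) (cmod z2)" 1] z by auto
  obtain K where K: "K > 0" "\<And>z. z \<in> cball 0 r \<Longrightarrow>
      cmod ((of_real K * cnj z)\<^sup>2 - 2 * b z * (of_real K * cnj z)) < K + K\<^sup>2 * (cmod z)\<^sup>2"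
    using circles_strictly_convex[OF \<open>c < 1\<close> r(3) cont bound b] by blast
  define \<psi> where "\<psi> z = exp (K * (cmod z)\<^sup>2)" for z :: complex
  note \<psi>_jet = wirtinger_jet_exp[OF wirtinger_jet_cmult[OF norm_square_jet[of unit_disk], of K], folded \<psi>_def]
  have \<psi>_convex: "cmod (of_real (\<psi> z) * (of_real K * 0 + (of_real K * cnj z)\<^sup>2)
        - 2 * b z * (of_real (\<psi> z) * (of_real K * cnj z)))
      < Re (of_real (\<psi> z) * (of_real K * 1 + of_real K * cnj z * cnj (of_real K * cnj z)))"
    if "z \<in> cball 0 r" for z
  proof -
    have "of_real (\<psi> z) * (of_real K * 0 + (of_real K * cnj z)\<^sup>2) - 2 * b z * (of_real (\<psi> z) * (of_real K * cnj z))
       = of_real (\<psi> z) * ((of_real K * cnj z)\<^sup>2 - 2 * b z * (of_real K * cnj z))"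
      by (simp add: algebra_simps)
    then have "cmod (of_real (\<psi> z) * (of_real K * 0 + (of_real K * cnj z)\<^sup>2)
        - 2 * b z * (of_real (\<psi> z) * (of_real K * cnj z)))
       = \<psi> z * cmod ((of_real K * cnj z)\<^sup>2 - 2 * b z * (of_real K * cnj z))"
      by (simp add: norm_mult \<psi>_def)
    also have "\<dots> < \<psi> z * (K + K\<^sup>2 * (cmod z)\<^sup>2)"
      using K(2)[OF that] by (simp add: \<psi>_def)
    also have "\<dots> = Re (of_real (\<psi> z) * (of_real K * 1 + of_real K * cnj z * cnj (of_real K * cnj z)))"
      by (simp add: cmod_power2) (simp add: power2_eq_square algebra_simps)
    finally show ?thesis .
  qed
  have sub: "cball 0 r \<subseteq> unit_disk" using r(3) by auto
  obtain \<eta>0 where \<eta>0: "\<eta>0 > 0" "\<And>z. z \<noteq> z1 \<Longrightarrow> dist z z1 < \<eta>0 \<Longrightarrow> 0 < U z"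
    using isolated unfolding eventually_at by blast
  obtain \<eta> where \<eta>: "0 < \<eta>" "\<eta> < min \<eta>0 (min (dist z1 z2) (1 - cmod z1))"
    using dense[of 0 "min \<eta>0 (min (dist z1 z2) (1 - cmod z1))"] \<eta>0(1) \<open>z1 \<noteq> z2\<close> z by auto
  have sphere: "sphere z1 \<eta> \<subseteq> unit_disk"
  proof
    fix y assume "y \<in> sphere z1 \<eta>"
    then show "y \<in> unit_disk" using \<eta> norm_triangle_ineq2[of y z1] by (simp add: dist_norm norm_minus_commute)
  qed
  have "continuous_on (sphere z1 \<eta>) U"
    using wirtinger_jetD(5)[OF U] sphere continuous_on_subset by blast
  moreover have "sphere z1 \<eta> \<noteq> {}" using \<eta>(1) by simp
  ultimately obtain y0 where y0: "y0 \<in> sphere z1 \<eta>" "\<And>y. y \<in> sphere z1 \<eta> \<Longrightarrow> U y0 \<le> U y"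
    using continuous_attains_inf[of "sphere z1 \<eta>" U] by auto
  define m where "m = U y0"
  have "m > 0" unfolding m_def using y0(1) \<eta> by (intro \<eta>0(2)) (auto simp: dist_commute)
  \<comment> \<open>On the unit disk \<open>\<psi>\<close> is at most \<open>exp K\<close>, so the perturbation is at most half the height \<open>m\<close> of the ridge.\<close>
  define \<epsilon> where "\<epsilon> = m / (2 * exp K)"
  have "\<epsilon> > 0" using \<open>m > 0\<close> by (simp add: \<epsilon>_def)
  note V_jet = wirtinger_jet_add[OF U wirtinger_jet_cmult[OF \<psi>_jet, of \<epsilon>]]
  define V where "V z = U z + \<epsilon> * \<psi> z" for z
  have "connected_component {y \<in> cball 0 r. V y \<le> max (V z1) (V z2)} z1 z2"
    unfolding V_def
  proof (rule connected_sublevel_of_strictly_convex[OF V_jet \<psi>_jet open_ball compact_cball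
        connected_cball, where R = "exp (K * r\<^sup>2)" and b = b])
    have "0 \<le> r" using r(1) norm_ge_zero[of z1] by linarith
    then have "\<psi> z \<le> exp (K * r\<^sup>2) \<longleftrightarrow> z \<in> cball 0 r" for z
      using K(1) by (simp add: \<psi>_def abs_le_square_iff[symmetric])
    then show "cball 0 r = {z \<in> unit_disk. \<psi> z \<le> exp (K * r\<^sup>2)}" using sub by blast
    fix z :: complex assume z: "z \<in> cball 0 r"
    let ?p1 = "of_real (\<psi> z) * (of_real K * cnj z)"
    let ?p2 = "of_real (\<psi> z) * (of_real K * 0 + (of_real K * cnj z)\<^sup>2)"
    let ?p3 = "of_real (\<psi> z) * (of_real K * 1 + of_real K * cnj z * cnj (of_real K * cnj z))"
    have "cmod ((U2 z + of_real \<epsilon> * ?p2) - 2 * b z * (U1 z + of_real \<epsilon> * ?p1))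
        = cmod ((U2 z - 2 * b z * U1 z) + of_real \<epsilon> * (?p2 - 2 * b z * ?p1))"
      by (simp add: algebra_simps)
    also have "\<dots> \<le> cmod (U2 z - 2 * b z * U1 z) + \<epsilon> * cmod (?p2 - 2 * b z * ?p1)"
      using \<open>\<epsilon> > 0\<close> by (intro order_trans[OF norm_triangle_ineq]) (simp add: norm_mult)
    also have "\<dots> < Re (U3 z) + \<epsilon> * Re ?p3"
      using convex[of z] \<psi>_convex[OF z] sub z \<open>\<epsilon> > 0\<close>
      by (intro add_le_less_mono mult_strict_left_mono) auto
    also have "\<dots> = Re (U3 z + of_real \<epsilon> * ?p3)" by simp
    finally show "cmod ((U2 z + of_real \<epsilon> * ?p2) - 2 * b z * (U1 z + of_real \<epsilon> * ?p1))
        < Re (U3 z + of_real \<epsilon> * ?p3)" .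
  qed (use \<psi>_convex r in auto)
  then obtain T where T: "connected T" "T \<subseteq> {y \<in> cball 0 r. V y \<le> max (V z1) (V z2)}" "z1 \<in> T" "z2 \<in> T"
    unfolding connected_component_def by blast
  have "T \<inter> frontier (ball z1 \<eta>) \<noteq> {}"
    using T(3,4) \<eta> by (intro connected_Int_frontier[OF T(1)]) auto
  then obtain y where y: "y \<in> T" "y \<in> sphere z1 \<eta>" using frontier_ball[OF \<eta>(1), of z1] by blast
  have small: "V z \<le> m / 2" if "z \<in> unit_disk" "U z = 0" for z
  proof -
    have "(cmod z)\<^sup>2 \<le> 1" using that(1) by (simp add: abs_square_le_1)
    then have "\<psi> z \<le> exp K" using K(1) by (simp add: \<psi>_def)
    then have "\<epsilon> * \<psi> z \<le> \<epsilon> * exp K" using \<open>\<epsilon> > 0\<close> by simp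
    also have "\<dots> = m / 2" by (simp add: \<epsilon>_def)
    finally show ?thesis using that(2) by (simp add: V_def)
  qed
  have "m \<le> U y" unfolding m_def by (rule y0(2)[OF y(2)])
  also have "\<dots> \<le> V y" using \<open>\<epsilon> > 0\<close> by (simp add: V_def \<psi>_def)
  also have "\<dots> \<le> m / 2" using T(2) y(1) small[OF z(1,3)] small[OF z(2,4)] by force
  finally show False using \<open>m > 0\<close> by simp
qed

section \<open>Injectivity of the lift\<close>

text \<open>The lift is conformal with factor \<open>\<bar>h'\<bar> + \<bar>g'\<bar>\<close>.\<close>

lemma immersion_norm:
  fixes a b k v :: complex
  assumes "k\<^sup>2 = a * b"
  shows "norm (a * v + cnj (b * v), 2 * Im (k * v)) = (cmod a + cmod b) * cmod v"
proof -
  have k: "(cmod k)\<^sup>2 = cmod a * cmod b" using assms by (metis norm_mult norm_power)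
  have im: "of_real (2 * Im w) = \<i> * (cnj w - w)" for w by (simp add: complex_eq_iff)
  have "complex_of_real ((cmod (a * v + cnj (b * v)))\<^sup>2 + (2 * Im (k * v))\<^sup>2)
      = (a * v + cnj (b * v)) * cnj (a * v + cnj (b * v)) + of_real (2 * Im (k * v)) * of_real (2 * Im (k * v))"
    unfolding of_real_add complex_norm_square by (simp only: power2_eq_square of_real_mult)
  also have "\<dots> = (a * cnj a + b * cnj b + 2 * (k * cnj k)) * (v * cnj v)"
  proof -
    have ck: "(cnj k)\<^sup>2 = cnj a * cnj b" using arg_cong[OF assms, of cnj] by simp
    have ii: "\<i> * \<i> = -1" by simp
    show ?thesis unfolding im complex_cnj_add complex_cnj_mult complex_cnj_cnj
      using ii ck assms by algebra
  qed
  also have "\<dots> = of_real (((cmod a + cmod b) * cmod v)\<^sup>2)"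
  proof -
    have "((cmod a + cmod b) * cmod v)\<^sup>2 = ((cmod a)\<^sup>2 + (cmod b)\<^sup>2 + 2 * (cmod k)\<^sup>2) * (cmod v)\<^sup>2"
      by (simp add: k power_mult_distrib power2_sum)
    then show ?thesis by (simp only: of_real_mult of_real_add complex_norm_square) simp
  qed
  finally have "(cmod (a * v + cnj (b * v)))\<^sup>2 + (2 * Im (k * v))\<^sup>2 = ((cmod a + cmod b) * cmod v)\<^sup>2"
    by (simp only: of_real_eq_iff)
  then show ?thesis by (simp add: norm_Pair)
qed

lemma has_derivative_bounded_below_imp_isolated:
  fixes F :: "'a::real_normed_vector \<Rightarrow> 'b::real_normed_vector"
  assumes F: "(F has_derivative F') (at x)" and "e > 0" and below: "\<And>v. norm (F' v) \<ge> e * norm v"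
  shows "\<forall>\<^sub>F y in at x. F y \<noteq> F x"
proof -
  have "e / 2 > 0" using \<open>e > 0\<close> by simp
  then obtain d where d: "d > 0" "\<And>y. norm (y - x) < d \<Longrightarrow> norm (F y - F x - F' (y - x)) \<le> e / 2 * norm (y - x)"
    using F unfolding has_derivative_at_alt by blast
  have "F y \<noteq> F x" if y: "y \<noteq> x" "dist y x < d" for y
  proof
    assume "F y = F x"
    then have "norm (F' (y - x)) \<le> e / 2 * norm (y - x)"
      using d(2)[of y] y(2) by (simp add: dist_norm)
    with below[of "y - x"] have "e * norm (y - x) \<le> e / 2 * norm (y - x)" by linarith
    then show False using \<open>e > 0\<close> y(1) by simp
  qed
  then show ?thesis unfolding eventually_at using d(1) by blast
qed

theorem corollary4p5:
  fixes f h g q :: "complex \<Rightarrow> complex" and \<tau> :: "complex \<Rightarrow> real" and c :: real and z0 :: complex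
  assumes "harmonic_mapping f h g"
    and "dilatation_is_square h g q"
    and "z0 \<in> unit_disk"
    and "smooth_on \<tau> unit_disk"
    and "c < 1"
    and "\<And>z. z \<in> unit_disk \<Longrightarrow>
           cmod (wirtinger (complex_of_real \<circ> \<tau>) z) \<le> c / (1 - (cmod z)\<^sup>2)"
    and "\<And>z. z \<in> unit_disk \<Longrightarrow>
           cmod (harmonic_schwarzian h g z
                 - 2 * (wirtinger (wirtinger (complex_of_real \<circ> \<tau>)) z
                        - (wirtinger (complex_of_real \<circ> \<tau>) z)\<^sup>2)
                 + 4 * cnj z * wirtinger (complex_of_real \<circ> \<tau>) z
                     / complex_of_real (1 - (cmod z)\<^sup>2))
           + exp (2 * log_conformal_factor h g z) * \<bar>gauss_curvature h g z\<bar>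
           \<le> 2 * (1 + (1 - (cmod z)\<^sup>2)\<^sup>2 * Re (wirtinger_bar (wirtinger (complex_of_real \<circ> \<tau>)) z))
               / (1 - (cmod z)\<^sup>2)\<^sup>2"
  shows "inj_on (weierstrass_enneper_lift f h q z0) unit_disk"
proof (rule inj_onI)
  let ?D = "unit_disk" and ?\<sigma> = "log_conformal_factor h g"
  fix z1 z2 assume z12: "z1 \<in> ?D" "z2 \<in> ?D"
    and lift: "weierstrass_enneper_lift f h q z0 z1 = weierstrass_enneper_lift f h q z0 z2"
  have holh: "h holomorphic_on ?D" and holg: "g holomorphic_on ?D"
    and fhg: "\<And>z. z \<in> ?D \<Longrightarrow> f z = h z + cnj (g z)"
    and nz: "\<And>z. z \<in> ?D \<Longrightarrow> cmod (deriv h z) + cmod (deriv g z) \<noteq> 0"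
    using assms(1) unfolding harmonic_mapping_def by auto
  have hol: "deriv h holomorphic_on ?D" "deriv g holomorphic_on ?D"
    using holh holg by (auto intro!: holomorphic_deriv)
  have q: "q meromorphic_on ?D"
    and qsq: "\<And>z. z \<in> ?D \<Longrightarrow> deriv h z \<noteq> 0 \<Longrightarrow> deriv g z / deriv h z = (q z)\<^sup>2"
    using assms(2) unfolding dilatation_is_square_def by auto
  obtain k pts where k: "k holomorphic_on ?D" "\<And>z. z \<in> ?D \<Longrightarrow> (k z)\<^sup>2 = deriv h z * deriv g z"
    and pts: "pts sparse_in ?D" "\<And>z. z \<in> ?D - pts \<Longrightarrow> k z = deriv h z * q z"
    using holomorphic_root_of_product[OF open_ball hol q qsq] by blast
  obtain W0 where W0: "\<And>z. z \<in> ?D \<Longrightarrow> (W0 has_field_derivative k z) (at z)"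
    using holomorphic_convex_primitive'[OF convex_ball open_ball k(1)]
    by (metis at_within_open open_ball)
  \<comment> \<open>Position vector of the lift relative to its value at \<open>z1\<close>, in complex and real components.\<close>
  define \<xi> where "\<xi> z = f z - f z1" for z
  define \<omega> where "\<omega> z = 2 * Im (W0 z - W0 z1)" for z
  have W: "contour_integral (linepath z0 z) (\<lambda>\<zeta>. deriv h \<zeta> * q \<zeta>) = W0 z - W0 z0" if z: "z \<in> ?D" for z
  proof -
    have seg: "closed_segment z0 z \<subseteq> ?D"
      using z assms(3) by (intro closed_segment_subset) auto
    have "contour_integral (linepath z0 z) (\<lambda>\<zeta>. deriv h \<zeta> * q \<zeta>) = contour_integral (linepath z0 z) k"
      using pts(2) by (intro contour_integral_linepath_eq_off_sparse[OF seg open_ball pts(1) k(1)]) auto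
    also have "\<dots> = W0 z - W0 z0"
    proof (rule contour_integral_unique)
      have "(k has_contour_integral (W0 (pathfinish (linepath z0 z)) - W0 (pathstart (linepath z0 z)))) (linepath z0 z)"
      proof (rule contour_integral_primitive)
        show "(W0 has_field_derivative k w) (at w within ?D)" if "w \<in> ?D" for w
          by (rule has_field_derivative_at_within[OF W0[OF that]])
      qed (use seg in simp_all)
      then show "(k has_contour_integral (W0 z - W0 z0)) (linepath z0 z)" by simp
    qed
    finally show ?thesis .
  qed
  have "Re (f z1) = Re (f z2)" "Im (f z1) = Im (f z2)" "Im (W0 z1 - W0 z0) = Im (W0 z2 - W0 z0)"
    using arg_cong[OF lift, of "\<lambda>v :: real ^ 3. v $ 1"] arg_cong[OF lift, of "\<lambda>v :: real ^ 3. v $ 2"]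
      arg_cong[OF lift, of "\<lambda>v :: real ^ 3. v $ 3"] W[OF z12(1)] W[OF z12(2)]
    by (auto simp: weierstrass_enneper_lift_def vector_3)
  then have at2: "\<xi> z2 = 0" "\<omega> z2 = 0" by (auto simp: \<xi>_def \<omega>_def complex_eq_iff)
  have at1: "\<xi> z1 = 0" "\<omega> z1 = 0" by (auto simp: \<xi>_def \<omega>_def)
  have d\<xi>: "(\<xi> has_derivative (\<lambda>v. deriv h z * v + cnj (deriv g z * v))) (at z)" if z: "z \<in> ?D" for z
  proof -
    have 1: "(h has_derivative (\<lambda>v. deriv h z * v)) (at z)" "(g has_derivative (\<lambda>v. deriv g z * v)) (at z)"
      using holomorphic_derivI[OF holh open_ball z] holomorphic_derivI[OF holg open_ball z]
      by (auto simp: has_field_derivative_def)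
    have "((\<lambda>z. h z + cnj (g z) - f z1) has_derivative (\<lambda>v. deriv h z * v + cnj (deriv g z * v))) (at z)"
      by (rule derivative_eq_intros 1 refl)+ simp
    then show ?thesis
      by (rule has_derivative_transform_within_open[OF _ open_ball z]) (simp add: \<xi>_def fhg)
  qed
  have d\<omega>: "(\<omega> has_derivative (\<lambda>v. 2 * Im (k z * v))) (at z)" if z: "z \<in> ?D" for z
    unfolding \<omega>_def
    by (rule derivative_eq_intros W0[OF z, unfolded has_field_derivative_def] refl)+ simp
  define P where "P z = (cmod (\<xi> z))\<^sup>2 + (\<omega> z)\<^sup>2" for z
  have P_jet: "wirtinger_jet ?D P
     (\<lambda>z. deriv h z * cnj (\<xi> z) + deriv g z * \<xi> z - 2 * \<i> * of_real (\<omega> z) * k z)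
     (\<lambda>z. deriv (deriv h) z * cnj (\<xi> z) + deriv (deriv g) z * \<xi> z - 2 * \<i> * of_real (\<omega> z) * deriv k z)
     (\<lambda>z. of_real ((cmod (deriv h z) + cmod (deriv g z))\<^sup>2))"
    unfolding P_def by (rule squared_distance_jet[OF open_ball hol k d\<xi> d\<omega>])
  have \<sigma>_jet: "wirtinger_jet ?D ?\<sigma> (wirtinger (complex_of_real \<circ> ?\<sigma>))
     (wirtinger (wirtinger (complex_of_real \<circ> ?\<sigma>))) (wirtinger_bar (wirtinger (complex_of_real \<circ> ?\<sigma>)))"
    by (rule log_conformal_factor_jet(1)[OF open_ball hol k nz])
  note \<tau>_jet = smooth_imp_wirtinger_jet[OF assms(4) open_ball]
  let ?\<tau>1 = "wirtinger (complex_of_real \<circ> \<tau>)"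
  note \<rho>_jet = wirtinger_jet_diff[OF \<tau>_jet ln_hyperbolic_jet]
  \<comment> \<open>The jet of \<open>U = exp (\<rho> - \<sigma>) P\<close> with \<open>\<rho> = \<tau> - ln (1 - \<bar>z\<bar>\<^sup>2)\<close>.\<close>
  note U_jet = wirtinger_jet_mult[OF wirtinger_jet_exp[OF wirtinger_jet_diff[OF \<rho>_jet \<sigma>_jet]] P_jet]
  show "z1 = z2"
  proof (rule no_second_zero_of_convex_function[OF assms(5) wirtinger_jetD(6)[OF \<tau>_jet] assms(6) _ U_jet _ z12,
        where b = "\<lambda>z. ?\<tau>1 z - - (cnj z / of_real (1 - (cmod z)\<^sup>2))"])
    show "?\<tau>1 z - - (cnj z / of_real (1 - (cmod z)\<^sup>2)) = ?\<tau>1 z + cnj z / of_real (1 - (cmod z)\<^sup>2)" for z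
      by simp
    show "exp (\<tau> z1 - ln (1 - (cmod z1)\<^sup>2) - ?\<sigma> z1) * P z1 = 0"
      "exp (\<tau> z2 - ln (1 - (cmod z2)\<^sup>2) - ?\<sigma> z2) * P z2 = 0"
      by (simp_all add: P_def at1 at2)
    \<comment> \<open>The lift is an immersion, so \<open>z1\<close> is an isolated zero of \<open>U\<close>.\<close>
    have "((\<lambda>z. (\<xi> z, \<omega> z)) has_derivative
        (\<lambda>v. (deriv h z1 * v + cnj (deriv g z1 * v), 2 * Im (k z1 * v)))) (at z1)"
      by (intro has_derivative_Pair d\<xi> d\<omega> z12)
    then have "\<forall>\<^sub>F z in at z1. (\<xi> z, \<omega> z) \<noteq> (\<xi> z1, \<omega> z1)"
    proof (rule has_derivative_bounded_below_imp_isolated)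
      show "0 < cmod (deriv h z1) + cmod (deriv g z1)"
        using nz[OF z12(1)] by (simp add: order_less_le)
    qed (simp only: immersion_norm[OF k(2)[OF z12(1)]] order_refl)
    then show "\<forall>\<^sub>F z in at z1. 0 < exp (\<tau> z - ln (1 - (cmod z)\<^sup>2) - ?\<sigma> z) * P z"
      by eventually_elim (auto simp: at1 P_def add_pos_nonneg add_nonneg_pos)
    fix z assume z: "z \<in> ?D"
    let ?u = "1 - (cmod z)\<^sup>2"
    let ?\<sigma>1 = "wirtinger (complex_of_real \<circ> ?\<sigma>)"
    have u: "?u > 0" using z by (simp add: abs_square_less_1)
    obtain a n t where ant: "wirtinger_bar ?\<sigma>1 z = of_real (a\<^sup>2)"
      "(cmod (\<xi> z))\<^sup>2 + (\<omega> z)\<^sup>2 = n\<^sup>2 + t\<^sup>2"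
      "cmod (deriv h z * cnj (\<xi> z) + deriv g z * \<xi> z - 2 * \<i> * of_real (\<omega> z) * k z) = exp (?\<sigma> z) * t"
      "cmod ((deriv (deriv h) z * cnj (\<xi> z) + deriv (deriv g) z * \<xi> z - 2 * \<i> * of_real (\<omega> z) * deriv k z)
         - 2 * ?\<sigma>1 z * (deriv h z * cnj (\<xi> z) + deriv g z * \<xi> z - 2 * \<i> * of_real (\<omega> z) * k z))
        \<le> 2 * exp (?\<sigma> z) * a * n"
      by atomize_elim (rule log_conformal_factor_jet(2)[OF open_ball hol k nz z])
    have e: "exp (?\<sigma> z) = cmod (deriv h z) + cmod (deriv g z)"
      using nz[OF z] by (simp add: log_conformal_factor_def order_less_le)
    have curv: "exp (2 * ?\<sigma> z) * \<bar>gauss_curvature h g z\<bar> = 4 * a\<^sup>2"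
      using wirtinger_jet_laplacian[OF \<sigma>_jet open_ball z] ant(1)
      by (simp add: gauss_curvature_def abs_mult exp_minus flip: of_real_power)
    have schw: "harmonic_schwarzian h g z = 2 * (wirtinger ?\<sigma>1 z - (?\<sigma>1 z)\<^sup>2)"
      by (simp add: harmonic_schwarzian_def Let_def)
    \<comment> \<open>The derivatives of \<open>\<rho>\<close>, with the signs as the rule for differences produces them.\<close>
    let ?\<rho>1 = "?\<tau>1 z - - (cnj z / of_real ?u)"
    let ?\<rho>2 = "wirtinger ?\<tau>1 z - - (cnj z / of_real ?u)\<^sup>2"
    let ?\<rho>3 = "wirtinger_bar ?\<tau>1 z - - 1 / of_real (?u\<^sup>2)"
    \<comment> \<open>The hypothesis is the bound on the difference of the Schwarzian derivatives of \<open>\<sigma>\<close> and \<open>\<rho>\<close>.\<close>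
    have "2 * (1 + ?u\<^sup>2 * Re (wirtinger_bar ?\<tau>1 z)) / ?u\<^sup>2 = 2 * Re ?\<rho>3"
    proof -
      have "Re (- 1 / complex_of_real (?u\<^sup>2)) = - 1 / ?u\<^sup>2" by (metis Re_complex_of_real of_real_1 of_real_divide of_real_minus)
      then show ?thesis using u by (simp add: field_simps del: of_real_power of_real_diff)
    qed
    moreover have "harmonic_schwarzian h g z - 2 * (wirtinger ?\<tau>1 z - (?\<tau>1 z)\<^sup>2)
          + 4 * cnj z * ?\<tau>1 z / complex_of_real ?u
        = 2 * (wirtinger ?\<sigma>1 z - (?\<sigma>1 z)\<^sup>2) - 2 * (?\<rho>2 - ?\<rho>1\<^sup>2)"
      unfolding schw by (simp add: power2_eq_square algebra_simps)
    ultimately have hyp: "cmod (2 * (wirtinger ?\<sigma>1 z - (?\<sigma>1 z)\<^sup>2) - 2 * (?\<rho>2 - ?\<rho>1\<^sup>2)) + 4 * a\<^sup>2 \<le> 2 * Re ?\<rho>3"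
      using assms(7)[OF z] unfolding curv by (simp only:)
    show "cmod ((of_real (exp (\<tau> z - ln ?u - ?\<sigma> z)) * ((?\<rho>2 - wirtinger ?\<sigma>1 z) + (?\<rho>1 - ?\<sigma>1 z)\<^sup>2) * of_real (P z)
        + 2 * (of_real (exp (\<tau> z - ln ?u - ?\<sigma> z)) * (?\<rho>1 - ?\<sigma>1 z)) *
            (deriv h z * cnj (\<xi> z) + deriv g z * \<xi> z - 2 * \<i> * of_real (\<omega> z) * k z)
        + of_real (exp (\<tau> z - ln ?u - ?\<sigma> z)) *
            (deriv (deriv h) z * cnj (\<xi> z) + deriv (deriv g) z * \<xi> z - 2 * \<i> * of_real (\<omega> z) * deriv k z))
       - 2 * ?\<rho>1 * (of_real (exp (\<tau> z - ln ?u - ?\<sigma> z)) * (?\<rho>1 - ?\<sigma>1 z) * of_real (P z)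
          + of_real (exp (\<tau> z - ln ?u - ?\<sigma> z)) *
            (deriv h z * cnj (\<xi> z) + deriv g z * \<xi> z - 2 * \<i> * of_real (\<omega> z) * k z)))
      \<le> Re (of_real (exp (\<tau> z - ln ?u - ?\<sigma> z)) *
           ((?\<rho>3 - wirtinger_bar ?\<sigma>1 z) + (?\<rho>1 - ?\<sigma>1 z) * cnj (?\<rho>1 - ?\<sigma>1 z)) * of_real (P z)
        + of_real (exp (\<tau> z - ln ?u - ?\<sigma> z)) * (?\<rho>1 - ?\<sigma>1 z) *
            cnj (deriv h z * cnj (\<xi> z) + deriv g z * \<xi> z - 2 * \<i> * of_real (\<omega> z) * k z)
        + cnj (of_real (exp (\<tau> z - ln ?u - ?\<sigma> z)) * (?\<rho>1 - ?\<sigma>1 z)) *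
            (deriv h z * cnj (\<xi> z) + deriv g z * \<xi> z - 2 * \<i> * of_real (\<omega> z) * k z)
        + of_real (exp (\<tau> z - ln ?u - ?\<sigma> z)) * of_real ((cmod (deriv h z) + cmod (deriv g z))\<^sup>2))"
      unfolding ant(1) e[symmetric]
      by (rule conformally_weighted_distance_convex_at[OF exp_gt_zero hyp _ ant(3,4)])
         (simp add: P_def ant(2))
  qed
qed

end
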